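(* Let $f:[0,1]\to\mathbb{R}$ be continuous. Then, almost surely, $$\gamma_T(f)\longrightarrow \gamma_\infty(f)\qquad\text{as } T\to+\infty .$$
   Context: Let $\mathcal{S}^{\downarrow}=\{\mathbf{s}=(s_1,s_2,\dots): s_1\ge s_2\ge\dots\ge 0,\ \sum_{i\ge 1}s_i\le 1\}$. Let $\nu$ (the dislocation measure) be a measure on $\mathcal{S}^{\downarrow}$ with $\nu(\mathcal{S}^{\downarrow})=1$, $\nu(s_1\in(0,1))=1$ and $\nu(\sum_{i\ge1}s_i=1)=1$. Let $\mathcal{U}=\{0\}\cup\bigcup_{n\ge1}(\mathbb{N}^* )^n$ be the infinite genealogical tree with root $0$; $ui$ denotes the $i$-th child of $u$ ($i\in\mathbb{N}^*$), and $\mathbf{a}(u)$ the parent of $u\ne0$. Let $((\widetilde\xi_{ui})_{i\in\mathbb{N}^*},u\in\mathcal{U})$ be an i.i.d. family of sequences, each of law $\nu$. Put $\xi_0=1$ and $\xi_{ui}=\widetilde\xi_{ui}\,\xi_u$ ($\xi_u$ is the size of the fragment indexed by $u$ in the fragmentation chain started from one block of size $1$). Let $\pi$ be the probability measure on $(0,+\infty)$ defined by $\int_{\mathcal{S}^{\downarrow}}\sum_{i\ge1}s_if(s_i)\,\nu(d\mathbf{s})=\int_0^{+\infty}f(e^{-x})\,\pi(dx)$ for all bounded measurable $f:[0,1]\to[0,+\infty)$. Assume that the support of $\pi$ is $[a,b]$ for some $0<a<b$, and that $\pi$ is absolutely continuous with respect to Lebesgue measure with a density continuous on $(0,+\infty)$.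 Put $\mu=\int_0^{+\infty}x\,\pi(dx)$ and, for bounded measurable $g:\mathbb{R}^+\to\mathbb{R}$, with $Y\sim\pi$, $$\eta(g)=\frac1\mu\int_{\mathbb{R}^+}\mathbb{E}\big(g(Y-s)\mathbf{1}_{\{Y-s\ge0\}}\big)\,ds .$$ For $\epsilon\in(0,1)$ put $T=-\log\epsilon$, $\mathcal{U}_\epsilon=\{u\in\mathcal{U}\setminus\{0\}:\xi_{\mathbf{a}(u)}\ge\epsilon,\ \xi_u<\epsilon\}$, and for bounded measurable $f:[0,1]\to\mathbb{R}$ $$\gamma_T(f)=\sum_{u\in\mathcal{U}_\epsilon}\xi_u\,f\!\left(\frac{\xi_u}{\epsilon}\right),\qquad \gamma_\infty(f)=\eta(\Phi(f)),\qquad \Phi(f)(y)=f(e^{-y})\ (y\ge0).$$ *)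

theory Defs
  imports "HOL-Probability.Probability"
begin

text \<open>
  Sequences and children are indexed from \<open>0\<close>: the entry \<open>s i\<close> is \<open>s\<^sub>i\<^sub>+\<^sub>1\<close> of the mathematical text,
  in particular \<open>s 0\<close> is the largest mass.
\<close>

definition mass_partitions :: "(nat \<Rightarrow> real) set" where
  "mass_partitions = {s. decseq s \<and> (\<forall>i. 0 \<le> s i) \<and> summable s \<and> (\<Sum>i. s i) \<le> 1}"

definition mass_partition_space :: "(nat \<Rightarrow> real) measure" where
  "mass_partition_space = restrict_space (\<Pi>\<^sub>M i\<in>UNIV. borel) mass_partitions"

definition dislocation_measure :: "(nat \<Rightarrow> real) measure \<Rightarrow> bool" where
  "dislocation_measure \<nu> \<longleftrightarrow>
     sets \<nu> = sets mass_partition_space \<and>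
     emeasure \<nu> mass_partitions = 1 \<and>
     emeasure \<nu> {s \<in> mass_partitions. 0 < s 0 \<and> s 0 < 1} = 1 \<and>
     emeasure \<nu> {s \<in> mass_partitions. (\<Sum>i. s i) = 1} = 1"

text \<open>
  A vertex of the genealogical tree is a list of child labels, most recent generation first:
  the root is \<open>[]\<close>, the child of \<open>u\<close> with label \<open>i\<close> is \<open>i # u\<close>, and the parent of \<open>u \<noteq> []\<close> is \<open>tl u\<close>.
  The argument \<open>r\<close> gives at each vertex the sequence of relative sizes of its children.
\<close>

type_synonym vertex = "nat list"

primrec frag_size :: "(vertex \<Rightarrow> nat \<Rightarrow> real) \<Rightarrow> vertex \<Rightarrow> real" where
  "frag_size r [] = 1"
| "frag_size r (i # u) = r u i * frag_size r u"

definition frozen_vertices :: "(vertex \<Rightarrow> real) \<Rightarrow> real \<Rightarrow> vertex set" where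
  "frozen_vertices \<xi> \<epsilon> = {u. u \<noteq> [] \<and> \<epsilon> \<le> \<xi> (tl u) \<and> \<xi> u < \<epsilon>}"

definition gamma_T :: "(vertex \<Rightarrow> real) \<Rightarrow> real \<Rightarrow> (real \<Rightarrow> real) \<Rightarrow> real" where
  "gamma_T \<xi> T f =
     (let \<epsilon> = exp (- T) in \<Sum>\<^sub>\<infinity>u\<in>frozen_vertices \<xi> \<epsilon>. \<xi> u * f (\<xi> u / \<epsilon>))"

text \<open>
  Probability measures on \<open>(0,\<infinity>)\<close> are represented as Borel probability measures on the reals
  that give full mass to \<open>{0<..}\<close>. Both sides of the identity below are integrals of nonnegative
  functions; taking all bounded test functions, it determines \<open>\<pi>\<close>.
\<close>

definition size_biased_law :: "(nat \<Rightarrow> real) measure \<Rightarrow> real measure \<Rightarrow> bool" where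
  "size_biased_law \<nu> \<pi> \<longleftrightarrow>
     prob_space \<pi> \<and> sets \<pi> = sets borel \<and> (AE x in \<pi>. 0 < x) \<and>
     (\<forall>f :: real \<Rightarrow> real.
        f \<in> borel_measurable (restrict_space borel {0..1}) \<longrightarrow>
        bounded (f ` {0..1}) \<longrightarrow> (\<forall>x\<in>{0..1}. 0 \<le> f x) \<longrightarrow>
        (\<integral>\<^sup>+ s. (\<Sum>i. ennreal (s i * f (s i))) \<partial>\<nu>) = (\<integral>\<^sup>+ x. ennreal (f (exp (- x))) \<partial>\<pi>))"

definition measure_support :: "'a::topological_space measure \<Rightarrow> 'a set" where
  "measure_support M = {x. \<forall>U. open U \<longrightarrow> x \<in> U \<longrightarrow> 0 < emeasure M U}"

definition has_continuous_density :: "real measure \<Rightarrow> bool" where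
  "has_continuous_density \<pi> \<longleftrightarrow>
     (\<exists>\<rho> :: real \<Rightarrow> real. continuous_on {0<..} \<rho> \<and> (\<forall>x>0. 0 \<le> \<rho> x) \<and>
        \<pi> = density lborel (\<lambda>x. ennreal (\<rho> x) * indicator {0<..} x))"

definition eta :: "real measure \<Rightarrow> (real \<Rightarrow> real) \<Rightarrow> real" where
  "eta \<pi> g =
     (1 / (LINT x|\<pi>. x)) *
     (LINT s:{0..}|lborel. (LINT y|\<pi>. (if 0 \<le> y - s then g (y - s) else 0)))"

definition Phi :: "(real \<Rightarrow> real) \<Rightarrow> real \<Rightarrow> real" where
  "Phi f y = f (exp (- y))"

definition gamma_infinity :: "real measure \<Rightarrow> (real \<Rightarrow> real) \<Rightarrow> real" where
  "gamma_infinity \<pi> f = eta \<pi> (Phi f)"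

end

theory Submission
  imports Defs
begin

text \<open>
  Why the theorem holds. Write \<open>\<xi>\<close> for the sizes and let \<open>Y\<close> have law \<open>\<pi>\<close>, the law of minus the
  logarithm of a size-biased relative size. Let \<open>A\<close> solve the renewal equation
  \<open>A t = E (A (t - Y))\<close> for \<open>t \<ge> 0\<close> with past \<open>A t = f (exp t)\<close> for \<open>t < 0\<close>; this is the expectation of
  \<open>\<gamma>\<^sub>t(f)\<close>. Two facts carry the proof.

  First, \<open>\<gamma>\<^sub>T(f)\<close> is close to its conditional mean given an early generation. Because all relative
  sizes that are not \<open>0\<close> lie in \<open>[exp (- b), exp (- a)]\<close>, no fragment of positive size in a generation
  \<open>n \<le> T / b\<close> is frozen, so the conditional mean is \<open>\<Sum> \<xi> u * A (T + ln (\<xi> u))\<close> over that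
  generation (\<open>gamma_T_decomposition\<close>). The
  difference is a sum over later vertices of innovations \<open>\<xi> u * D u\<close>, where \<open>D u\<close> is bounded and
  centred with respect to the splitting at \<open>u\<close> alone. Innovations at distinct vertices are therefore
  orthogonal (\<open>Y_orthogonal\<close>), and since the squared sizes of generation \<open>k\<close> sum to at most
  \<open>exp (- a k)\<close>, the second moment of the difference is of order \<open>exp (- a n)\<close>. Along a lattice of
  times, with \<open>n\<close> about \<open>T / (2 b)\<close>, these moments are summable, which gives almost sure convergence
  of the difference to \<open>0\<close> (\<open>lattice_convergence\<close>).

  Secondly, \<open>A\<close> converges at infinity (\<open>renewal_limit\<close>). The continuous density makes \<open>A\<close> uniformly
  continuous. If \<open>L\<close> is its upper limit and \<open>A (t n)\<close> tends to \<open>L\<close>, then \<open>A (t n)\<close>, being an average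
  of \<open>A\<close> over the preceding \<open>[t n - b, t n - a]\<close>, can only be close to \<open>L\<close> if \<open>A\<close> is close to \<open>L\<close> there;
  by iteration it is close to \<open>L\<close> on \<open>[t n - k b, t n - k a]\<close>, which is longer than \<open>b\<close> for large \<open>k\<close>.
  The quantity \<open>E (\<integral> A over (t - Y, t])\<close> does not depend on \<open>t\<close>, and along such windows it tends to
  \<open>L * E Y\<close>. So \<open>L\<close> is determined by the value at \<open>t = 0\<close>, which depends only on the past and is
  \<open>E Y * \<gamma>\<^sub>\<infinity>(f)\<close>. The same argument for \<open>- A\<close> shows that the lower limit has the same value.

  It remains to pass from lattice times to all times. Between \<open>S\<close> and \<open>S + d\<close> only those frozen
  fragments can split again whose size relative to the threshold is at least \<open>exp (- d)\<close>, and the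
  relative sizes of the others hardly change (\<open>gamma_T_increment\<close>). The total mass of
  the former is bounded by \<open>\<gamma>\<^sub>S\<close> of a continuous bump, whose limit is at most \<open>2 d / E Y\<close> (\<open>gamma_infinity_bump\<close>).
\<close>

section \<open>The genealogical tree with bounded splitting ratios\<close>

text \<open>
  Restricting the labels to \<open>{..<N}\<close> makes every generation finite. Nothing is lost: a splitting with
  ratios at least \<open>exp (- b)\<close> has at most \<open>exp b\<close> children of positive size.
\<close>

definition generation :: "nat \<Rightarrow> nat \<Rightarrow> vertex set" where
  "generation N m = {u. set u \<subseteq> {..<N} \<and> length u = m}"

lemma finite_generation [simp]: "finite (generation N m)"
  unfolding generation_def by (rule finite_lists_length_eq) simp

lemma generation_0 [simp]: "generation N 0 = {[]}"
  by (auto simp: generation_def)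

lemma sum_generation_Suc:
  "(\<Sum>v\<in>generation N (Suc m). F v) = (\<Sum>u\<in>generation N m. \<Sum>i<N. F (i # u))"
proof -
  have eq: "generation N (Suc m) = (\<lambda>(u, i). i # u) ` (generation N m \<times> {..<N})"
    by (auto simp: generation_def length_Suc_conv image_iff)
  have "inj_on (\<lambda>(u, i). i # u) (generation N m \<times> {..<N})"
    by (auto simp: inj_on_def)
  then show ?thesis
    unfolding eq by (simp add: sum.reindex sum.cartesian_product split_def)
qed

text \<open>
  The root is left out because it is never frozen.
\<close>

definition early_vertices :: "nat \<Rightarrow> nat \<Rightarrow> vertex set" where
  "early_vertices N m = (\<Union>k<m. generation N (Suc k))"

lemma finite_early_vertices [simp]: "finite (early_vertices N m)"
  by (simp add: early_vertices_def)

lemma sum_early_vertices: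
  "(\<Sum>v\<in>early_vertices N m. F v) = (\<Sum>k<m. \<Sum>v\<in>generation N (Suc k). F v)"
  unfolding early_vertices_def
  by (rule sum.UNION_disjoint) (simp, simp, auto simp: generation_def)

text \<open>
  When \<open>A t\<close> is the expectation of \<open>\<gamma>\<^sub>t(f)\<close>, this is the change in the conditional expectation of
  \<open>\<gamma>\<^sub>T(f)\<close> caused by revealing how the fragment \<open>u\<close> splits. Fragments that are already below the
  threshold \<open>exp (- T)\<close> no longer contribute.
\<close>

definition innovation ::
  "nat \<Rightarrow> real \<Rightarrow> (real \<Rightarrow> real) \<Rightarrow> (vertex \<Rightarrow> nat \<Rightarrow> real) \<Rightarrow> vertex \<Rightarrow> real" where
  "innovation N T A r u =
     (if exp (- T) \<le> frag_size r u
      then frag_size r u *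
             ((\<Sum>i<N. r u i * A (T + ln (frag_size r (i # u)))) - A (T + ln (frag_size r u)))
      else 0)"

locale bounded_splitting =
  fixes N :: nat and a b :: real and r :: "vertex \<Rightarrow> nat \<Rightarrow> real"
  assumes a_pos: "0 < a" and a_less_b: "a < b"
    and ratio: "r u i = 0 \<or> exp (- b) \<le> r u i \<and> r u i \<le> exp (- a)"
    and ratio_eq_0: "N \<le> i \<Longrightarrow> r u i = 0"
    and ratio_sum: "(\<Sum>i<N. r u i) = 1"
begin

abbreviation \<xi> :: "vertex \<Rightarrow> real" where "\<xi> \<equiv> frag_size r"

lemma ratio_nonneg: "0 \<le> r u i"
  using ratio[of u i] exp_gt_zero[of "-b"] by linarith

lemma ratio_le_1: "r u i \<le> 1"
proof -
  have "exp (- a) \<le> 1" using a_pos by simp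
  then show ?thesis using ratio[of u i] by linarith
qed

lemma size_nonneg: "0 \<le> \<xi> u"
  by (induction u) (auto simp: ratio_nonneg)

lemma size_Cons_le: "\<xi> (i # u) \<le> \<xi> u"
  using mult_right_mono[OF ratio_le_1 size_nonneg, of u i u] by simp

lemma size_bounds:
  "\<xi> u = 0 \<or> exp (- (b * length u)) \<le> \<xi> u \<and> \<xi> u \<le> exp (- (a * length u))"
proof (induction u)
  case (Cons i u)
  have "exp (- (b * length (i # u))) = exp (- b) * exp (- (b * length u))"
    "exp (- (a * length (i # u))) = exp (- a) * exp (- (a * length u))"
    by (auto simp: exp_add[symmetric] algebra_simps)
  then show ?case
    using Cons ratio[of u i] ratio_nonneg[of u i] size_nonneg[of u]
    by (auto intro!: mult_mono)
qed simp

lemma size_le: "\<xi> u \<le> exp (- (a * length u))"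
  using size_bounds[of u] by (auto simp: less_imp_le)

lemma size_le_1: "\<xi> u \<le> 1"
proof -
  have "exp (- (a * length u)) \<le> 1" using a_pos by simp
  then show ?thesis using size_le[of u] by linarith
qed

lemma size_eq_0_outside: "u \<notin> generation N (length u) \<Longrightarrow> \<xi> u = 0"
proof (induction u)
  case (Cons i u)
  then show ?case
    by (cases "i < N") (auto simp: generation_def ratio_eq_0)
qed (simp add: generation_def)

lemma generation_mass: "(\<Sum>u\<in>generation N m. \<xi> u) = 1"
proof (induction m)
  case (Suc m)
  then show ?case
    by (simp add: sum_generation_Suc sum_distrib_right[symmetric] ratio_sum)
qed simp

text \<open>
  This exponential decay is what makes the fluctuations summable: one factor of each square is at
  most \<open>exp (- (a * m))\<close>, and the other factors add up to the total mass.
\<close>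

lemma generation_sum_squares: "(\<Sum>u\<in>generation N m. (\<xi> u)\<^sup>2) \<le> exp (- (a * m))"
proof -
  have "(\<Sum>u\<in>generation N m. (\<xi> u)\<^sup>2) \<le> (\<Sum>u\<in>generation N m. exp (- (a * m)) * \<xi> u)"
  proof (rule sum_mono)
    fix u assume "u \<in> generation N m"
    then have "\<xi> u \<le> exp (- (a * m))" using size_le[of u] by (simp add: generation_def)
    then show "(\<xi> u)\<^sup>2 \<le> exp (- (a * m)) * \<xi> u"
      unfolding power2_eq_square using size_nonneg by (rule mult_right_mono)
  qed
  also have "\<dots> = exp (- (a * m))"
    by (simp add: sum_distrib_left[symmetric] generation_mass)
  finally show ?thesis .
qed

lemma innovation_bound:
  assumes "\<And>t. \<bar>A t\<bar> \<le> C"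
  shows "\<bar>innovation N T A r u\<bar> \<le> 2 * C * \<xi> u"
proof -
  have "\<bar>\<Sum>i<N. r u i * A (T + ln (\<xi> (i # u)))\<bar> \<le> (\<Sum>i<N. \<bar>r u i * A (T + ln (\<xi> (i # u)))\<bar>)"
    by (rule sum_abs)
  also have "\<dots> \<le> (\<Sum>i<N. r u i * C)"
    using assms by (intro sum_mono) (simp add: abs_mult ratio_nonneg mult_left_mono)
  also have "\<dots> = C" by (simp add: sum_distrib_right[symmetric] ratio_sum)
  finally have 1: "\<bar>\<Sum>i<N. r u i * A (T + ln (\<xi> (i # u)))\<bar> \<le> C" .
  have "\<bar>(\<Sum>i<N. r u i * A (T + ln (\<xi> (i # u)))) - A (T + ln (\<xi> u))\<bar> \<le> 2 * C"
    using 1 assms[of "T + ln (\<xi> u)"] by linarith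
  from mult_left_mono[OF this size_nonneg[of u]]
  have "\<bar>\<xi> u * ((\<Sum>i<N. r u i * A (T + ln (\<xi> (i # u)))) - A (T + ln (\<xi> u)))\<bar> \<le> 2 * C * \<xi> u"
    by (simp add: abs_mult size_nonneg mult.commute)
  moreover have "0 \<le> 2 * C * \<xi> u" using assms[of 0] size_nonneg[of u] by simp
  ultimately show ?thesis unfolding innovation_def by auto
qed

definition frozen_sum :: "real \<Rightarrow> (real \<Rightarrow> real) \<Rightarrow> nat \<Rightarrow> real" where
  "frozen_sum T A m = (\<Sum>k<m. \<Sum>v\<in>generation N (Suc k).
     if exp (- T) \<le> \<xi> (tl v) \<and> \<xi> v < exp (- T) then \<xi> v * A (T + ln (\<xi> v)) else 0)"

definition active_sum :: "real \<Rightarrow> (real \<Rightarrow> real) \<Rightarrow> nat \<Rightarrow> real" where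
  "active_sum T A m = (\<Sum>u\<in>generation N m.
     if exp (- T) \<le> \<xi> u then \<xi> u * A (T + ln (\<xi> u)) else 0)"

text \<open>
  A child of an active fragment is either active or newly frozen. So the two sums together change
  only by replacing the contribution of each active fragment by that of its children.
\<close>

lemma stage_step:
  "active_sum T A (Suc m) + frozen_sum T A (Suc m) =
     active_sum T A m + frozen_sum T A m + (\<Sum>u\<in>generation N m. innovation N T A r u)"
proof -
  have "active_sum T A (Suc m) + (frozen_sum T A (Suc m) - frozen_sum T A m) =
      (\<Sum>u\<in>generation N m. \<Sum>i<N.
         (if exp (- T) \<le> \<xi> (i # u) then \<xi> (i # u) * A (T + ln (\<xi> (i # u))) else 0) +
         (if exp (- T) \<le> \<xi> u \<and> \<xi> (i # u) < exp (- T)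
          then \<xi> (i # u) * A (T + ln (\<xi> (i # u))) else 0))"
    unfolding active_sum_def frozen_sum_def sum_generation_Suc by (simp add: sum.distrib)
  also have "\<dots> = (\<Sum>u\<in>generation N m. \<Sum>i<N.
      if exp (- T) \<le> \<xi> u then \<xi> (i # u) * A (T + ln (\<xi> (i # u))) else 0)"
  proof (intro sum.cong refl)
    fix u i
    show "(if exp (- T) \<le> \<xi> (i # u) then \<xi> (i # u) * A (T + ln (\<xi> (i # u))) else 0) +
        (if exp (- T) \<le> \<xi> u \<and> \<xi> (i # u) < exp (- T)
         then \<xi> (i # u) * A (T + ln (\<xi> (i # u))) else 0) =
        (if exp (- T) \<le> \<xi> u then \<xi> (i # u) * A (T + ln (\<xi> (i # u))) else 0)"
      using size_Cons_le[of i u] by (auto simp del: frag_size.simps)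
  qed
  also have "\<dots> = (\<Sum>u\<in>generation N m.
      innovation N T A r u + (if exp (- T) \<le> \<xi> u then \<xi> u * A (T + ln (\<xi> u)) else 0))"
    by (intro sum.cong refl) (auto simp: innovation_def sum_distrib_left algebra_simps)
  finally show ?thesis unfolding active_sum_def by (simp add: sum.distrib)
qed

lemma stage_telescope:
  assumes "n \<le> m"
  shows "active_sum T A m + frozen_sum T A m =
     active_sum T A n + frozen_sum T A n +
       (\<Sum>k\<in>{n..<m}. \<Sum>u\<in>generation N k. innovation N T A r u)"
  using assms
proof (induction m rule: dec_induct)
  case (step m)
  then show ?case by (simp add: stage_step)
qed simp

lemma active_sum_late:
  assumes "T < a * m"
  shows "active_sum T A m = 0"
  unfolding active_sum_def
proof (rule sum.neutral, rule ballI)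
  fix u assume "u \<in> generation N m"
  then have "\<xi> u \<le> exp (- (a * m))" using size_le[of u] by (simp add: generation_def)
  also have "\<dots> < exp (- T)" using assms by simp
  finally show "(if exp (- T) \<le> \<xi> u then \<xi> u * A (T + ln (\<xi> u)) else 0) = 0" by simp
qed

text \<open>
  Up to generation \<open>T / b\<close> no fragment of positive size can have fallen below the threshold.
\<close>

lemma size_early:
  assumes "b * length u \<le> T"
  shows "\<xi> u = 0 \<or> exp (- T) \<le> \<xi> u"
proof -
  have "exp (- T) \<le> exp (- (b * length u))" using assms by simp
  then show ?thesis using size_bounds[of u] by linarith
qed

lemma active_sum_early:
  assumes "b * m \<le> T"
  shows "active_sum T A m = (\<Sum>u\<in>generation N m. \<xi> u * A (T + ln (\<xi> u)))"
  unfolding active_sum_def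
  using assms size_early by (intro sum.cong refl) (force simp: generation_def)

lemma frozen_sum_early:
  assumes "b * m \<le> T"
  shows "frozen_sum T A m = 0"
  unfolding frozen_sum_def
proof (intro sum.neutral ballI)
  fix k v assume "k \<in> {..<m}" "v \<in> generation N (Suc k)"
  then have "length v \<le> m" by (auto simp: generation_def)
  then have "b * length v \<le> b * m" using a_pos a_less_b by (intro mult_left_mono) auto
  then have "\<xi> v = 0 \<or> exp (- T) \<le> \<xi> v" using assms by (intro size_early) linarith
  then show "(if exp (- T) \<le> \<xi> (tl v) \<and> \<xi> v < exp (- T) then \<xi> v * A (T + ln (\<xi> v)) else 0) = 0"
    by auto
qed

lemma gamma_T_finite_sum:
  assumes "T < a * m"
  shows "gamma_T \<xi> T f = (\<Sum>v\<in>early_vertices N m.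
     if exp (- T) \<le> \<xi> (tl v) \<and> \<xi> v < exp (- T) then \<xi> v * f (\<xi> v / exp (- T)) else 0)"
proof -
  define V where "V = early_vertices N m"
  have fin: "finite V" by (simp add: V_def)
  have "gamma_T \<xi> T f = (\<Sum>\<^sub>\<infinity>u\<in>frozen_vertices \<xi> (exp (- T)). \<xi> u * f (\<xi> u / exp (- T)))"
    by (simp add: gamma_T_def Let_def)
  also have "\<dots> = (\<Sum>\<^sub>\<infinity>u\<in>V. if exp (- T) \<le> \<xi> (tl u) \<and> \<xi> u < exp (- T)
       then \<xi> u * f (\<xi> u / exp (- T)) else 0)"
  proof (rule infsum_cong_neutral)
    fix u assume u: "u \<in> V - frozen_vertices \<xi> (exp (- T))"
    then have "u \<noteq> []" by (auto simp: V_def early_vertices_def generation_def)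
    with u show "(if exp (- T) \<le> \<xi> (tl u) \<and> \<xi> u < exp (- T)
       then \<xi> u * f (\<xi> u / exp (- T)) else 0) = 0"
      by (auto simp: frozen_vertices_def)
  next
    fix u assume u: "u \<in> frozen_vertices \<xi> (exp (- T)) - V"
    then obtain i w where iw: "u = i # w" by (cases u) (auto simp: frozen_vertices_def)
    have "exp (- T) \<le> \<xi> w" using u iw by (simp add: frozen_vertices_def)
    also note size_le[of w]
    finally have "exp (- T) \<le> exp (- (a * length w))" .
    then have "a * length w \<le> T" by simp
    then have "a * length w < a * m" using assms by simp
    then have "length w < m" using a_pos by simp
    then have "u \<notin> generation N (length u)"
      using u iw by (auto simp: V_def early_vertices_def)
    then show "\<xi> u * f (\<xi> u / exp (- T)) = 0" by (simp add: size_eq_0_outside)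
  qed (auto simp: frozen_vertices_def)
  also have "\<dots> = (\<Sum>u\<in>V. if exp (- T) \<le> \<xi> (tl u) \<and> \<xi> u < exp (- T)
       then \<xi> u * f (\<xi> u / exp (- T)) else 0)"
    by (rule infsum_finite[OF fin])
  finally show ?thesis by (simp add: V_def)
qed

lemma gamma_T_eq_frozen_sum:
  assumes "T < a * m" and "\<And>t. t < 0 \<Longrightarrow> A t = f (exp t)"
  shows "gamma_T \<xi> T f = frozen_sum T A m"
  unfolding gamma_T_finite_sum[OF assms(1)] sum_early_vertices frozen_sum_def
proof (intro sum.cong refl)
  fix v
  have "A (T + ln (\<xi> v)) = f (\<xi> v / exp (- T))" if "\<xi> v < exp (- T)" "\<xi> v \<noteq> 0"
  proof -
    have pos: "0 < \<xi> v" using that(2) size_nonneg[of v] by linarith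
    then have "ln (\<xi> v) < - T" using that(1) by (metis ln_exp ln_less_cancel_iff exp_gt_zero)
    then have "A (T + ln (\<xi> v)) = f (exp (T + ln (\<xi> v)))" by (intro assms(2)) simp
    also have "exp (T + ln (\<xi> v)) = \<xi> v / exp (- T)"
      using pos by (simp add: exp_add exp_minus field_simps)
    finally show ?thesis .
  qed
  then show "(if exp (- T) \<le> \<xi> (tl v) \<and> \<xi> v < exp (- T) then \<xi> v * f (\<xi> v / exp (- T)) else 0) =
    (if exp (- T) \<le> \<xi> (tl v) \<and> \<xi> v < exp (- T) then \<xi> v * A (T + ln (\<xi> v)) else 0)"
    by (cases "\<xi> v = 0") auto
qed

text \<open>
  The telescoped identity between a generation \<open>n\<close> in which nothing is frozen and a generation \<open>m\<close>
  in which everything is. The assumption on \<open>A\<close> identifies a frozen fragment's \<open>A (T + ln (\<xi> v))\<close>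
  with its contribution to \<open>\<gamma>\<^sub>T(f)\<close>.
\<close>

lemma gamma_T_decomposition:
  assumes "b * n \<le> T" and "T < a * m" and "n \<le> m" and "\<And>t. t < 0 \<Longrightarrow> A t = f (exp t)"
  shows "gamma_T \<xi> T f = (\<Sum>u\<in>generation N n. \<xi> u * A (T + ln (\<xi> u))) +
     (\<Sum>k\<in>{n..<m}. \<Sum>u\<in>generation N k. innovation N T A r u)"
  using stage_telescope[OF assms(3), of T A] active_sum_late[OF assms(2)]
    active_sum_early[OF assms(1)] frozen_sum_early[OF assms(1)]
    gamma_T_eq_frozen_sum[where A = A and f = f, OF assms(2) assms(4)] by simp

text \<open>
  Mass is conserved: the constant function \<open>1\<close> has no innovations.
\<close>

lemma gamma_T_one:
  assumes "0 \<le> T"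
  shows "gamma_T \<xi> T (\<lambda>_. 1) = 1"
proof -
  obtain m :: nat where m: "T < a * m"
    using reals_Archimedean3[OF a_pos] by (auto simp: mult.commute)
  have "innovation N T (\<lambda>_. 1) r u = 0" for u
    by (simp add: innovation_def ratio_sum)
  then show ?thesis
    using gamma_T_decomposition[where n = 0 and m = m and T = T and A = "\<lambda>_. 1" and f = "\<lambda>_. 1"]
      assms m by simp
qed

text \<open>
  A fragment frozen at both times contributes almost the same amount, since its rescaled size moves by
  at most \<open>d\<close>. The fragments frozen at time \<open>S\<close> only have rescaled size at least \<open>exp (- d)\<close>, hence
  mass at most \<open>\<gamma>\<^sub>S(h)\<close>; by conservation of mass the fragments frozen at time \<open>T\<close> only have the same
  total mass.
\<close>

lemma gamma_T_increment:
  assumes "0 \<le> S" "S \<le> T" "T \<le> S + d"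
    and f_bound: "\<And>x. \<bar>f x\<bar> \<le> C"
    and f_mod: "\<And>x y. x \<in> {0..1} \<Longrightarrow> y \<in> {0..1} \<Longrightarrow> \<bar>x - y\<bar> \<le> d \<Longrightarrow> \<bar>f x - f y\<bar> \<le> e"
    and h_nonneg: "\<And>x. 0 \<le> h x" and h_one: "\<And>x. exp (- d) \<le> x \<Longrightarrow> h x = 1"
  shows "\<bar>gamma_T \<xi> T f - gamma_T \<xi> S f\<bar> \<le> e + 2 * C * gamma_T \<xi> S h"
proof -
  obtain m :: nat where mT: "T < a * m"
    using reals_Archimedean3[OF a_pos] by (auto simp: mult.commute)
  then have mS: "S < a * m" using assms by simp
  define V where "V = early_vertices N m"
  define F where "F = (\<lambda>t v. exp (- t) \<le> \<xi> (tl v) \<and> \<xi> v < exp (- t))"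
  define w where "w = (\<lambda>t g v. if F t v then \<xi> v * g (\<xi> v / exp (- t)) else (0 :: real))"
  have gT: "gamma_T \<xi> T g = (\<Sum>v\<in>V. w T g v)" and gS: "gamma_T \<xi> S g = (\<Sum>v\<in>V. w S g v)" for g
    using gamma_T_finite_sum[OF mT, of g] gamma_T_finite_sum[OF mS, of g]
    by (simp_all add: V_def w_def F_def)
  have C: "0 \<le> C" using f_bound[of 0] by linarith
  have e: "0 \<le> e" using f_mod[of 0 0] assms by simp
  \<comment> \<open>The middle term sums to \<open>0\<close> by conservation of mass. It transfers the mass of vertices frozen at
      \<open>T\<close> only to vertices frozen at \<open>S\<close> only, where \<open>h\<close> controls it.\<close>
  have "\<bar>w T f v - w S f v\<bar> \<le>
      e * w S (\<lambda>_. 1) v + C * (w T (\<lambda>_. 1) v - w S (\<lambda>_. 1) v) + 2 * C * w S h v" for v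
  proof -
    let ?x = "\<xi> v / exp (- T)" and ?y = "\<xi> v / exp (- S)"
    have pos: "0 \<le> \<xi> v" by (rule size_nonneg)
    have fx: "\<bar>\<xi> v * f z\<bar> \<le> \<xi> v * C" for z
      using pos f_bound by (simp add: abs_mult mult_left_mono)
    have hC: "0 \<le> C * (\<xi> v * h ?y)"
      using pos C h_nonneg by simp
    consider "F T v" "F S v" | "F T v" "\<not> F S v" | "\<not> F T v" "F S v" | "\<not> F T v" "\<not> F S v" by blast
    then show ?thesis
    proof cases
      case 1
      have ratio: "?y = ?x * exp (- (T - S))" by (simp add: exp_diff exp_minus field_simps)
      have x: "0 \<le> ?x" "?x \<le> 1" using 1 pos by (auto simp: F_def divide_le_eq_1)
      have y: "0 \<le> ?y" "?y \<le> 1" using 1 pos by (auto simp: F_def divide_le_eq_1)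
      have E: "exp (- (T - S)) \<le> 1" "1 - (T - S) \<le> exp (- (T - S))"
        using assms(2) exp_ge_add_one_self[of "- (T - S)"] by (simp, linarith)
      have "?x - ?y = ?x * (1 - exp (- (T - S)))" unfolding ratio by (simp add: right_diff_distrib)
      moreover have "0 \<le> ?x * (1 - exp (- (T - S)))"
        using x E by (intro mult_nonneg_nonneg) auto
      moreover have "?x * (1 - exp (- (T - S))) \<le> 1 * d"
        using x E assms by (intro mult_mono) auto
      ultimately have "\<bar>?x - ?y\<bar> \<le> d" by linarith
      then have "\<bar>f ?x - f ?y\<bar> \<le> e" using x y by (intro f_mod) auto
      then have "\<bar>\<xi> v * (f ?x - f ?y)\<bar> \<le> \<xi> v * e"
        unfolding abs_mult abs_of_nonneg[OF pos] by (rule mult_left_mono[OF _ pos])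
      then show ?thesis using 1 hC by (simp add: w_def right_diff_distrib mult.commute)
    next
      case 2
      then show ?thesis using fx[of ?x] by (simp add: w_def mult.commute)
    next
      case 3
      have "exp (- T) \<le> exp (- S)" using assms by simp
      then have "exp (- T) \<le> \<xi> v" using 3 unfolding F_def by linarith
      moreover have "exp (- d) * exp (- S) \<le> exp (- T)" using assms by (simp flip: exp_add)
      ultimately have "exp (- d) \<le> ?y" by (simp add: le_divide_eq)
      then have "h ?y = 1" by (rule h_one)
      moreover have "0 \<le> e * \<xi> v" using e pos by simp
      ultimately show ?thesis using 3 fx[of ?y] by (simp add: w_def mult.commute)
    next
      case 4
      then show ?thesis by (simp add: w_def)
    qed
  qed
  then have "(\<Sum>v\<in>V. \<bar>w T f v - w S f v\<bar>) \<le>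
      (\<Sum>v\<in>V. e * w S (\<lambda>_. 1) v + C * (w T (\<lambda>_. 1) v - w S (\<lambda>_. 1) v) + 2 * C * w S h v)"
    by (intro sum_mono)
  also have "\<dots> = e * gamma_T \<xi> S (\<lambda>_. 1) + C * (gamma_T \<xi> T (\<lambda>_. 1) - gamma_T \<xi> S (\<lambda>_. 1))
      + 2 * C * gamma_T \<xi> S h"
    unfolding gT gS sum.distrib sum_subtractf sum_distrib_left[symmetric] ..
  also have "\<dots> = e + 2 * C * gamma_T \<xi> S h"
    using assms by (simp add: gamma_T_one)
  finally have "(\<Sum>v\<in>V. \<bar>w T f v - w S f v\<bar>) \<le> e + 2 * C * gamma_T \<xi> S h" .
  moreover have "\<bar>gamma_T \<xi> T f - gamma_T \<xi> S f\<bar> \<le> (\<Sum>v\<in>V. \<bar>w T f v - w S f v\<bar>)"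
    unfolding gT gS sum_subtractf[symmetric] by (rule sum_abs)
  ultimately show ?thesis by linarith
qed

lemma gamma_T_cong:
  assumes "\<And>x. x \<in> {0..1} \<Longrightarrow> f x = g x"
  shows "gamma_T \<xi> T f = gamma_T \<xi> T g"
  unfolding gamma_T_def Let_def
proof (rule infsum_cong)
  fix u assume "u \<in> frozen_vertices \<xi> (exp (- T))"
  then have "\<xi> u / exp (- T) \<in> {0..1}"
    using size_nonneg[of u] by (auto simp: frozen_vertices_def divide_le_eq_1)
  then show "\<xi> u * f (\<xi> u / exp (- T)) = \<xi> u * g (\<xi> u / exp (- T))"
    using assms by simp
qed

end

section \<open>The renewal theorem\<close>

text \<open>
  When jumps are at least \<open>a > 0\<close>, the equation determines its solution on \<open>[n a, (n + 1) a)\<close> from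
  its values to the left. Hence the iterates are constant from step \<open>n\<close> on at all times below
  \<open>n a\<close>, whatever the starting value on \<open>[0, \<infinity>)\<close>; the value \<open>0\<close> is a default.
\<close>

primrec renewal_iterate :: "real measure \<Rightarrow> (real \<Rightarrow> real) \<Rightarrow> nat \<Rightarrow> real \<Rightarrow> real" where
  "renewal_iterate \<pi> g 0 t = (if t < 0 then g t else 0)"
| "renewal_iterate \<pi> g (Suc n) t =
     (if t < 0 then g t else (LINT x|\<pi>. renewal_iterate \<pi> g n (t - x)))"

lemma renewal_function_exists:
  fixes \<pi> :: "real measure" and g :: "real \<Rightarrow> real"
  assumes "prob_space \<pi>" and sets_pi: "sets \<pi> = sets borel"
    and a: "0 < a" and jump: "AE x in \<pi>. a \<le> x"
    and g_meas [measurable]: "g \<in> borel_measurable borel" and g_bound: "\<And>t. \<bar>g t\<bar> \<le> C"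
  obtains A where "A \<in> borel_measurable borel" "\<And>t. \<bar>A t\<bar> \<le> C"
    "\<And>t. t < 0 \<Longrightarrow> A t = g t" "\<And>t. 0 \<le> t \<Longrightarrow> A t = (LINT x|\<pi>. A (t - x))"
proof -
  interpret prob_space \<pi> by fact
  note [measurable_cong] = sets_pi
  let ?I = "renewal_iterate \<pi> g"
  have C: "0 \<le> C" using g_bound[of 0] by linarith
  have meas [measurable]: "?I n \<in> borel_measurable borel" for n
  proof (induction n)
    case 0
    show ?case by simp
  next
    case (Suc n)
    note [measurable] = Suc
    show ?case by simp
  qed
  have bound: "\<bar>?I n t\<bar> \<le> C" for n t
  proof (induction n arbitrary: t)
    case (Suc n)
    have "\<bar>LINT x|\<pi>. ?I n (t - x)\<bar> \<le> (LINT x|\<pi>. C)"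
      by (rule integral_abs_bound_integral)
        (auto intro!: integrable_const_bound[where B = C] simp: Suc)
    then show ?case using g_bound prob_space by simp
  qed (simp add: g_bound C)
  have stable: "?I m t = ?I n t" if "t < real n * a" "n \<le> m" for m n t
    using that
  proof (induction n arbitrary: m t)
    case 0
    then show ?case by (cases m) auto
  next
    case (Suc n)
    from Suc.prems obtain m' where m': "m = Suc m'" "n \<le> m'" by (cases m) auto
    have "(LINT x|\<pi>. ?I m' (t - x)) = (LINT x|\<pi>. ?I n (t - x))"
    proof (rule integral_cong_AE)
      show "AE x in \<pi>. ?I m' (t - x) = ?I n (t - x)"
        using jump
      proof eventually_elim
        case (elim x)
        then have "t - x < real n * a" using Suc.prems by (simp add: algebra_simps)
        then show ?case using m'(2) by (rule Suc.IH)
      qed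
    qed auto
    then show ?case using m' by simp
  qed
  define A where "A = (\<lambda>t. ?I (nat \<lceil>t / a\<rceil> + 1) t)"
  have A_eq: "A t = ?I n t" if "t < real n * a" for n t
  proof -
    have "t / a < real (nat \<lceil>t / a\<rceil> + 1)" by linarith
    then have 1: "t < real (nat \<lceil>t / a\<rceil> + 1) * a" using a by (simp add: field_simps)
    show ?thesis unfolding A_def
      using stable[OF 1, of "max n (nat \<lceil>t / a\<rceil> + 1)"]
        stable[OF that, of "max n (nat \<lceil>t / a\<rceil> + 1)"] by simp
  qed
  have ev: "eventually (\<lambda>n. ?I n t = A t) sequentially" for t
  proof -
    obtain n0 :: nat where n0: "t < real n0 * a" using reals_Archimedean3[OF a] by blast
    have "?I n t = A t" if "n0 \<le> n" for n
    proof -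
      have "real n0 * a \<le> real n * a" using that a by simp
      then show ?thesis using n0 by (intro A_eq[symmetric]) simp
    qed
    then show ?thesis by (auto simp: eventually_sequentially)
  qed
  show ?thesis
  proof
    show [measurable]: "A \<in> borel_measurable borel"
      by (rule borel_measurable_LIMSEQ_real[where u = ?I])
        (rule tendsto_eventually[OF ev], rule meas)
    show "\<bar>A t\<bar> \<le> C" for t unfolding A_def by (rule bound)
    show "A t = g t" if "t < 0" for t using A_eq[of t 0] that by simp
    show "A t = (LINT x|\<pi>. A (t - x))" if "0 \<le> t" for t
    proof -
      obtain n :: nat where n: "t < real n * a" using reals_Archimedean3[OF a] by blast
      then have n': "t < real (Suc n) * a" using a by (simp add: algebra_simps)
      have "A t = (LINT x|\<pi>. ?I n (t - x))" using A_eq[OF n'] that by simp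
      also have "\<dots> = (LINT x|\<pi>. A (t - x))"
      proof (rule integral_cong_AE)
        show "AE x in \<pi>. ?I n (t - x) = A (t - x)"
          using jump
        proof eventually_elim
          case (elim x)
          then show ?case using n a by (intro A_eq[symmetric]) simp
        qed
      qed auto
      finally show ?thesis .
    qed
  qed
qed

lemma integrable_indicator_interval [simp]:
  "integrable lborel (indicator {c..d} :: real \<Rightarrow> real)"
  by (cases "c \<le> d") (auto simp: integrable_real_indicator)

text \<open>
  A bounded solution of the renewal equation for a jump law with a continuous density whose support
  is exactly \<open>[a, b]\<close>. The past of the solution, on the negative half-line, is arbitrary.
\<close>

locale renewal =
  fixes \<pi> :: "real measure" and a b C :: real and \<rho> A :: "real \<Rightarrow> real"
  assumes prob: "prob_space \<pi>"
    and a_pos: "0 < a" and a_less_b: "a < b"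
    and density: "\<pi> = density lborel (\<lambda>x. ennreal (\<rho> x))"
    and \<rho>_cont: "continuous_on UNIV \<rho>" and \<rho>_nonneg: "0 \<le> \<rho> x"
    and \<rho>_outside: "x \<notin> {a..b} \<Longrightarrow> \<rho> x = 0"
    and charged: "x \<in> {a..b} \<Longrightarrow> 0 < e \<Longrightarrow> 0 < measure \<pi> (ball x e)"
    and A_meas [measurable]: "A \<in> borel_measurable borel"
    and A_bound: "\<bar>A t\<bar> \<le> C"
    and A_renewal: "0 \<le> t \<Longrightarrow> A t = (LINT x|\<pi>. A (t - x))"
begin

sublocale prob_space \<pi> by (rule prob)

lemma sets_\<pi> [simp, measurable_cong]: "sets \<pi> = sets borel"
  by (simp add: density)

lemma space_\<pi> [simp]: "space \<pi> = UNIV"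
  by (simp add: density)

lemma \<rho>_meas [measurable]: "\<rho> \<in> borel_measurable borel"
  by (rule borel_measurable_continuous_onI[OF \<rho>_cont])

lemma C_nonneg: "0 \<le> C"
  using A_bound[of 0] by linarith

lemma AE_jump: "AE x in \<pi>. x \<in> {a..b}"
  unfolding density
  by (subst AE_density) (use \<rho>_outside in \<open>force intro!: AE_I2 simp del: atLeastAtMost_iff\<close>)+

lemma A_integrable: "integrable \<pi> (\<lambda>x. A (t - x))"
  by (rule integrable_const_bound[where B = C]) (auto simp: A_bound)

lemma A_convolution:
  assumes "0 \<le> t"
  shows "A t = (LINT s|lborel. \<rho> (t - s) * A s)"
proof -
  have "A t = (LINT x|lborel. \<rho> x * A (t - x))"
    unfolding A_renewal[OF assms] density
    by (subst integral_density) (auto simp: \<rho>_nonneg)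
  also have "\<dots> = (LINT s|lborel. \<rho> (t - s) * A s)"
    by (subst lborel_integral_real_affine[where t = t and c = "-1"]) auto
  finally show ?thesis .
qed

lemma \<rho>_integrable: "integrable lborel (\<lambda>s. \<rho> (t - s) * A s)"
proof -
  have "integrable lborel (\<lambda>x. \<rho> x * A (t - x))"
    using A_integrable[of t] unfolding density
    by (subst (asm) integrable_density) (auto simp: \<rho>_nonneg)
  then show ?thesis
    by (subst (asm) lborel_integrable_real_affine_iff[where t = t and c = "-1", symmetric]) auto
qed

lemma \<rho>_uniform:
  assumes "0 < e"
  obtains d where "0 < d" "\<And>x y. \<bar>x - y\<bar> < d \<Longrightarrow> \<bar>\<rho> x - \<rho> y\<bar> \<le> e"
proof -
  have "uniformly_continuous_on {a-1..b+1} \<rho>"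
    by (rule compact_uniformly_continuous) (auto intro: continuous_on_subset[OF \<rho>_cont])
  then obtain d where d: "0 < d"
    "\<And>x y. x \<in> {a-1..b+1} \<Longrightarrow> y \<in> {a-1..b+1} \<Longrightarrow> \<bar>x - y\<bar> < d \<Longrightarrow> \<bar>\<rho> x - \<rho> y\<bar> < e"
    unfolding uniformly_continuous_on_def dist_real_def using assms by (metis abs_minus_commute)
  show ?thesis
  proof (rule that[of "min d 1"])
    fix x y :: real assume xy: "\<bar>x - y\<bar> < min d 1"
    show "\<bar>\<rho> x - \<rho> y\<bar> \<le> e"
    proof (cases "x \<in> {a..b} \<or> y \<in> {a..b}")
      case True
      then have "x \<in> {a-1..b+1}" "y \<in> {a-1..b+1}" using xy by auto
      then show ?thesis using d(2)[of x y] xy by simp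
    next
      case False
      then show ?thesis using \<rho>_outside assms by simp
    qed
  qed (use d in simp)
qed

text \<open>
  At nonnegative times \<open>A\<close> is the convolution of a bounded function with a uniformly continuous
  density of compact support.
\<close>

lemma A_uniform:
  assumes "0 < e"
  obtains d where "0 < d"
    "\<And>s t. 0 \<le> s \<Longrightarrow> 0 \<le> t \<Longrightarrow> \<bar>s - t\<bar> < d \<Longrightarrow> \<bar>A s - A t\<bar> \<le> e"
proof -
  \<comment> \<open>\<open>b + 2\<close> is the length of an interval containing the supports of both shifted densities when the two
      times differ by less than \<open>1\<close>; \<open>C + 1\<close> avoids division by \<open>0\<close>.\<close>
  define e' where "e' = e / ((C + 1) * (b + 2))"
  have e': "0 < e'" "e' * C * (b + 2) \<le> e"
    using assms C_nonneg a_pos a_less_b by (auto simp: e'_def divide_simps mult_left_mono)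
  obtain d where d: "0 < d" "\<And>x y. \<bar>x - y\<bar> < d \<Longrightarrow> \<bar>\<rho> x - \<rho> y\<bar> \<le> e'"
    using \<rho>_uniform[OF e'(1)] by blast
  show ?thesis
  proof (rule that[of "min d 1"])
    fix s t :: real assume st: "0 \<le> s" "0 \<le> t" "\<bar>s - t\<bar> < min d 1"
    have "\<bar>A s - A t\<bar> = \<bar>LINT r|lborel. (\<rho> (s - r) - \<rho> (t - r)) * A r\<bar>"
      unfolding A_convolution[OF st(1)] A_convolution[OF st(2)]
      by (subst Bochner_Integration.integral_diff[symmetric])
        (auto simp: \<rho>_integrable left_diff_distrib)
    also have "\<dots> \<le> (LINT r|lborel. e' * C * indicator {t - b - 1..t + 1} r)"
    proof (rule integral_abs_bound_integral)
      show "integrable lborel (\<lambda>r. (\<rho> (s - r) - \<rho> (t - r)) * A r)"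
        using Bochner_Integration.integrable_diff[OF \<rho>_integrable \<rho>_integrable, of s t]
        by (simp add: left_diff_distrib)
      fix r
      show "\<bar>(\<rho> (s - r) - \<rho> (t - r)) * A r\<bar> \<le> e' * C * indicator {t - b - 1..t + 1} r"
      proof (cases "r \<in> {t - b - 1..t + 1}")
        case True
        have "\<bar>\<rho> (s - r) - \<rho> (t - r)\<bar> * \<bar>A r\<bar> \<le> e' * C"
          using d(2)[of "s - r" "t - r"] st A_bound[of r] e' by (intro mult_mono) auto
        then show ?thesis using True by (simp add: abs_mult)
      next
        case False
        then have "\<rho> (s - r) = 0" "\<rho> (t - r) = 0"
          using st a_pos by (auto intro!: \<rho>_outside)
        then show ?thesis using e' C_nonneg by simp
      qed
    qed simp
    also have "\<dots> = e' * C * (b + 2)"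
      using a_pos a_less_b by simp
    also have "\<dots> \<le> e" by (rule e')
    finally show "\<bar>A s - A t\<bar> \<le> e" .
  qed (use d in simp)
qed

text \<open>
  An average of values that do not exceed \<open>L\<close> by much cannot be close to \<open>L\<close> if one of the averaged
  values is well below \<open>L\<close>: by uniform continuity \<open>A\<close> would then be well below \<open>L\<close> on a whole
  neighbourhood, which the jump law charges.
\<close>

lemma limsup_propagates_step:
  assumes t: "filterlim t at_top sequentially"
    and upper: "\<And>e. 0 < e \<Longrightarrow> eventually (\<lambda>s. A s \<le> L + e) at_top"
    and lim: "(\<lambda>n. A (t n)) \<longlonglongrightarrow> L"
    and x: "x \<in> {a..b}"
  shows "(\<lambda>n. A (t n - x)) \<longlonglongrightarrow> L"
proof (rule LIMSEQ_I)
  fix e :: real assume "0 < e"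
  define k where "k = e / 4"
  have k: "0 < k" using \<open>0 < e\<close> by (simp add: k_def)
  obtain d where d: "0 < d"
    "\<And>s t. 0 \<le> s \<Longrightarrow> 0 \<le> t \<Longrightarrow> \<bar>s - t\<bar> < d \<Longrightarrow> \<bar>A s - A t\<bar> \<le> k"
    using A_uniform[OF k] by blast
  define p where "p = measure \<pi> (ball x d)"
  have p: "0 < p" unfolding p_def using charged[OF x d(1)] .
  have p1: "p \<le> 1" unfolding p_def by (rule prob_le_1)
  \<comment> \<open>Small enough that a deficit \<open>k\<close> on a set of mass \<open>p\<close> outweighs an excess \<open>q\<close> everywhere and a
      deviation \<open>q\<close> of \<open>A (t n)\<close> from \<open>L\<close>.\<close>
  define q where "q = k * p / 2"
  have q: "0 < q" "q \<le> k" using k p p1 mult_left_mono[of p 1 k] by (auto simp: q_def)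
  obtain S where S: "\<And>s. S \<le> s \<Longrightarrow> A s \<le> L + q"
    using upper[OF q(1)] by (auto simp: eventually_at_top_linorder)
  have ev1: "eventually (\<lambda>n. \<bar>A (t n) - L\<bar> < q) sequentially"
    using lim q(1) by (auto simp: tendsto_iff dist_real_def)
  have ev2: "eventually (\<lambda>n. max 0 S + b + d \<le> t n) sequentially"
    using t by (auto simp: filterlim_at_top)
  have "eventually (\<lambda>n. norm (A (t n - x) - L) < e) sequentially"
    using ev1 ev2
  proof eventually_elim
    case (elim n)
    have tn: "0 \<le> t n" using elim a_pos a_less_b d by auto
    have up: "A (t n - y) \<le> L + q" if "y \<in> {a..b}" for y
      using that elim d by (intro S) auto
    have "A (t n - x) \<ge> L - 2 * k"
    proof (rule ccontr)
      assume neg: "\<not> A (t n - x) \<ge> L - 2 * k"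
      have low: "A (t n - y) \<le> L - k" if "y \<in> {a..b}" "y \<in> ball x d" for y
      proof -
        have "\<bar>A (t n - y) - A (t n - x)\<bar> \<le> k"
          using that x elim by (intro d(2)) (auto simp: dist_real_def abs_minus_commute)
        then show ?thesis using neg by linarith
      qed
      have "A (t n) = (LINT y|\<pi>. A (t n - y))" by (rule A_renewal[OF tn])
      also have "\<dots> \<le> (LINT y|\<pi>. L + q - (k + q) * indicator (ball x d) y)"
      proof (rule integral_mono_AE)
        show "integrable \<pi> (\<lambda>y. L + q - (k + q) * indicator (ball x d) y)"
          by (intro Bochner_Integration.integrable_diff integrable_mult_right
              integrable_real_indicator) (auto simp: less_top[symmetric])
        show "AE y in \<pi>. A (t n - y) \<le> L + q - (k + q) * indicator (ball x d) y"
          using AE_jump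
        proof eventually_elim
          case (elim y)
          then show ?case using up[of y] low[of y] by (cases "y \<in> ball x d") auto
        qed
      qed (rule A_integrable)
      also have "\<dots> = L + q - (k + q) * p"
        by (subst Bochner_Integration.integral_diff)
          (use prob_space in \<open>auto simp: p_def less_top[symmetric]\<close>)
      finally have "A (t n) \<le> L + q - (k + q) * p" .
      moreover have "q + q \<le> (k + q) * p"
        using q p by (simp add: q_def algebra_simps)
      ultimately show False using elim by linarith
    qed
    moreover have "A (t n - x) \<le> L + k" using up[OF x] q by linarith
    ultimately show ?case using k by (simp add: k_def abs_le_iff)
  qed
  then show "\<exists>no. \<forall>n\<ge>no. norm (A (t n - x) - L) < e"
    by (auto simp: eventually_sequentially)
qed

lemma limsup_propagates:
  assumes t: "filterlim t at_top sequentially"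
    and upper: "\<And>e. 0 < e \<Longrightarrow> eventually (\<lambda>s. A s \<le> L + e) at_top"
    and lim: "(\<lambda>n. A (t n)) \<longlonglongrightarrow> L"
    and x: "x \<in> {real k * a..real k * b}"
  shows "(\<lambda>n. A (t n - x)) \<longlonglongrightarrow> L"
  using x
proof (induction k arbitrary: x)
  case 0
  then show ?case using lim by simp
next
  case (Suc k)
  \<comment> \<open>Split the shift into equal jumps, each of which lies in \<open>[a, b]\<close>.\<close>
  define y where "y = x / real (Suc k)"
  have y: "y \<in> {a..b}" using Suc.prems by (auto simp: y_def field_simps)
  have "x = real (Suc k) * y" by (simp add: y_def)
  then have xy: "x = real k * y + y" by (simp add: algebra_simps)
  have "(\<lambda>n. A (t n - real k * y)) \<longlonglongrightarrow> L"
    using y by (intro Suc.IH) (auto intro: mult_left_mono)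
  moreover have "filterlim (\<lambda>n. t n - real k * y) at_top sequentially"
    using filterlim_tendsto_add_at_top[OF tendsto_const t, of "- (real k * y)"] by simp
  ultimately have "(\<lambda>n. A ((t n - real k * y) - y)) \<longlonglongrightarrow> L"
    using upper y by (intro limsup_propagates_step[where t = "\<lambda>n. t n - real k * y"])
  then show ?case by (simp add: xy algebra_simps)
qed

text \<open>
  The half-open interval \<open>(c, d]\<close> makes additivity hold without a case distinction at end points.
\<close>

definition A_integral :: "real \<Rightarrow> real \<Rightarrow> real" where
  "A_integral c d = (LINT s|lborel. (if c < s \<and> s \<le> d then A s else 0))"

lemma A_integral_integrable: "integrable lborel (\<lambda>s. if c < s \<and> s \<le> d then A s else 0)"
proof (rule Bochner_Integration.integrable_bound)
  show "integrable lborel (\<lambda>s. C * indicator {c..d} s)" by simp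
  show "AE s in lborel. norm (if c < s \<and> s \<le> d then A s else 0) \<le> norm (C * indicator {c..d} s)"
    using A_bound C_nonneg by (auto simp: indicator_def)
qed simp

lemma A_integral_bound: "c \<le> d \<Longrightarrow> \<bar>A_integral c d\<bar> \<le> C * (d - c)"
proof -
  assume "c \<le> d"
  have "\<bar>A_integral c d\<bar> \<le> (LINT s|lborel. C * indicator {c..d} s)"
    unfolding A_integral_def
    by (rule integral_abs_bound_integral[OF A_integral_integrable])
      (simp, use A_bound C_nonneg in \<open>auto simp: indicator_def\<close>)
  then show ?thesis using \<open>c \<le> d\<close> by simp
qed

lemma A_integral_add: "c \<le> d \<Longrightarrow> d \<le> e \<Longrightarrow> A_integral c d + A_integral d e = A_integral c e"
  unfolding A_integral_def
  by (subst Bochner_Integration.integral_add[OF A_integral_integrable A_integral_integrable, symmetric])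
    (auto intro!: Bochner_Integration.integral_cong)

lemma A_integral_shift: "A_integral (c - x) (d - x) = (LINT s|lborel. (if c < s \<and> s \<le> d then A (s - x) else 0))"
  unfolding A_integral_def
  by (subst lborel_integral_real_affine[where t = "- x" and c = 1])
    (auto intro!: Bochner_Integration.integral_cong)

lemma A_integral_reflect: "A_integral (t - x) t = (LINT s|lborel. (if 0 \<le> s \<and> s < x then A (t - s) else 0))"
  unfolding A_integral_def
  by (subst lborel_integral_real_affine[where t = t and c = "- 1"])
    (auto intro!: Bochner_Integration.integral_cong)

lemma A_integral_meas [measurable]:
  assumes [measurable]: "c \<in> borel_measurable borel" "d \<in> borel_measurable borel"
  shows "(\<lambda>x. A_integral (c x) (d x)) \<in> borel_measurable borel"
  unfolding A_integral_def by measurable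

text \<open>
  The conserved quantity of the renewal equation: the expected integral of \<open>A\<close> over the last jump
  interval \<open>(t - Y, t]\<close>.
\<close>

definition window :: "real \<Rightarrow> real" where
  "window t = (LINT x|\<pi>. A_integral (t - x) t)"

lemma A_integral_jump_integrable:
  assumes "t \<le> t'"
  shows "integrable \<pi> (\<lambda>x. A_integral (t - x) (t' - x))"
proof (rule integrable_const_bound[where B = "C * (t' - t)"])
  have "norm (A_integral (t - x) (t' - x)) \<le> C * (t' - t)" for x
    using A_integral_bound[of "t - x" "t' - x"] assms by simp
  then show "AE x in \<pi>. norm (A_integral (t - x) (t' - x)) \<le> C * (t' - t)" by simp
qed simp

lemma window_integrable: "integrable \<pi> (\<lambda>x. A_integral (t - x) t)"
proof (rule integrable_const_bound[where B = "C * b"])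
  show "AE x in \<pi>. norm (A_integral (t - x) t) \<le> C * b"
    using AE_jump
  proof eventually_elim
    case (elim x)
    then have "\<bar>A_integral (t - x) t\<bar> \<le> C * x" using A_integral_bound[of "t - x" t] a_pos by simp
    also have "\<dots> \<le> C * b" using elim C_nonneg by (intro mult_left_mono) auto
    finally show ?case by simp
  qed
qed simp

lemma A_integral_average:
  assumes "0 \<le> t"
  shows "(LINT x|\<pi>. A_integral (- x) (t - x)) = A_integral 0 t"
proof -
  interpret pair_sigma_finite \<pi> lborel
    by unfold_locales
  have int: "integrable (\<pi> \<Otimes>\<^sub>M lborel) (\<lambda>(x, s). if 0 < s \<and> s \<le> t then A (s - x) else 0)"
  proof (rule Fubini_integrable)
    show "(\<lambda>(x, s). if 0 < s \<and> s \<le> t then A (s - x) else 0) \<in> borel_measurable (\<pi> \<Otimes>\<^sub>M lborel)"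
      by measurable
    have i: "integrable lborel (\<lambda>s. if 0 < s \<and> s \<le> t then A (s - x) else 0)" for x
    proof (rule Bochner_Integration.integrable_bound)
      show "integrable lborel (\<lambda>s. C * indicator {0..t} s)" by simp
    qed (use A_bound C_nonneg in \<open>auto simp: indicator_def\<close>)
    then show "AE x in \<pi>. integrable lborel
        (\<lambda>s. case (x, s) of (x, s) \<Rightarrow> if 0 < s \<and> s \<le> t then A (s - x) else 0)" by simp
    show "integrable \<pi> (\<lambda>x. LINT s|lborel. norm
        (case (x, s) of (x, s) \<Rightarrow> if 0 < s \<and> s \<le> t then A (s - x) else 0))"
    proof (rule integrable_const_bound[where B = "C * t"])
      have "\<bar>LINT s|lborel. \<bar>if 0 < s \<and> s \<le> t then A (s - x) else 0\<bar>\<bar>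
          \<le> (LINT s|lborel. C * indicator {0..t} s)" for x
        using integrable_abs[OF i[of x]]
        by (intro integral_abs_bound_integral)
          (simp, simp, use A_bound C_nonneg in \<open>auto simp: indicator_def\<close>)
      then show "AE x in \<pi>. norm (LINT s|lborel. norm
          (case (x, s) of (x, s) \<Rightarrow> if 0 < s \<and> s \<le> t then A (s - x) else 0)) \<le> C * t"
        using assms by simp
    qed simp
  qed
  have "(LINT x|\<pi>. A_integral (- x) (t - x)) =
      (LINT x|\<pi>. LINT s|lborel. (if 0 < s \<and> s \<le> t then A (s - x) else 0))"
    using A_integral_shift[of 0 _ t] by simp
  also have "\<dots> = (LINT s|lborel. LINT x|\<pi>. (if 0 < s \<and> s \<le> t then A (s - x) else 0))"
    using Fubini_integral[OF int] by simp
  also have "\<dots> = A_integral 0 t"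
    unfolding A_integral_def
    by (intro Bochner_Integration.integral_cong) (auto simp: A_renewal)
  finally show ?thesis .
qed

text \<open>
  Both \<open>(t - x, t]\<close> together with \<open>(- x, t - x]\<close> and \<open>(- x, 0]\<close> together with \<open>(0, t]\<close> make up
  \<open>(- x, t]\<close>. On average over the jump \<open>x\<close> the integral over \<open>(- x, t - x]\<close> equals that over
  \<open>(0, t]\<close>, by the renewal equation and Fubini's theorem, so these two parts cancel.
\<close>

lemma window_const:
  assumes "0 \<le> t"
  shows "window t = window 0"
proof -
  have "window t + (LINT x|\<pi>. A_integral (- x) (t - x)) = (LINT x|\<pi>. A_integral (t - x) t + A_integral (- x) (t - x))"
    unfolding window_def using window_integrable A_integral_jump_integrable[of 0 t] assms
    by (subst Bochner_Integration.integral_add) auto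
  also have "\<dots> = (LINT x|\<pi>. A_integral (0 - x) 0 + A_integral 0 t)"
  proof (intro integral_cong_AE)
    show "AE x in \<pi>. A_integral (t - x) t + A_integral (- x) (t - x) = A_integral (0 - x) 0 + A_integral 0 t"
      using AE_jump
    proof eventually_elim
      case (elim x)
      then show ?case
        using A_integral_add[of "-x" 0 t] A_integral_add[of "-x" "t-x" t] a_pos assms by simp
    qed
  qed auto
  also have "\<dots> = window 0 + A_integral 0 t"
    unfolding window_def using window_integrable[of 0] prob_space
    by (subst Bochner_Integration.integral_add) auto
  finally show ?thesis using A_integral_average[OF assms] by simp
qed

lemma jump_integrable: "integrable \<pi> (\<lambda>x. x)"
  by (rule integrable_const_bound[where B = b]) (use AE_jump a_pos in auto)

lemma mean_pos: "0 < (LINT x|\<pi>. x)"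
proof -
  have "(LINT x|\<pi>. a) \<le> (LINT x|\<pi>. x)"
    by (rule integral_mono_AE[OF _ jump_integrable]) (use AE_jump in auto)
  then show ?thesis using a_pos prob_space by simp
qed

lemma window_limit:
  assumes "\<And>s. s \<in> {0..b} \<Longrightarrow> (\<lambda>n. A (t n - s)) \<longlonglongrightarrow> L"
  shows "(\<lambda>n. window (t n)) \<longlonglongrightarrow> L * (LINT x|\<pi>. x)"
proof -
  have "(\<lambda>n. A_integral (t n - x) (t n)) \<longlonglongrightarrow> L * x" if x: "x \<in> {a..b}" for x
  proof -
    have "(\<lambda>n. LINT s|lborel. (if 0 \<le> s \<and> s < x then A (t n - s) else 0))
        \<longlonglongrightarrow> (LINT s|lborel. L * indicator {0..<x} s)"
    proof (rule integral_dominated_convergence)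
      show "integrable lborel (\<lambda>s. C * indicator {0..b} s)" by simp
      show "AE s in lborel. (\<lambda>n. if 0 \<le> s \<and> s < x then A (t n - s) else 0)
          \<longlonglongrightarrow> L * indicator {0..<x} s"
        using assms x by (intro AE_I2) (auto simp: indicator_def)
      show "AE s in lborel. norm (if 0 \<le> s \<and> s < x then A (t n - s) else 0)
          \<le> C * indicator {0..b} s" for n
        using A_bound C_nonneg x by (auto simp: indicator_def)
    qed auto
    then show ?thesis using x a_pos by (simp add: A_integral_reflect)
  qed
  then have "(\<lambda>n. LINT x|\<pi>. A_integral (t n - x) (t n)) \<longlonglongrightarrow> (LINT x|\<pi>. L * x)"
  proof (intro integral_dominated_convergence[where w = "\<lambda>_. C * b"])
    show "AE x in \<pi>. norm (A_integral (t n - x) (t n)) \<le> C * b" for n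
      using AE_jump
    proof eventually_elim
      case (elim x)
      then have "\<bar>A_integral (t n - x) (t n)\<bar> \<le> C * x" using A_integral_bound[of "t n - x" "t n"] a_pos by simp
      also have "\<dots> \<le> C * b" using elim C_nonneg by (intro mult_left_mono) auto
      finally show ?case by simp
    qed
  qed (use AE_jump in auto)
  then show ?thesis by (simp add: window_def)
qed

text \<open>
  Along a sequence of times at which \<open>A\<close> tends to its upper limit \<open>L\<close>, it also tends to \<open>L\<close> at every
  point of certain intervals of length \<open>b\<close> before them. The conserved quantity at the right end points
  of these intervals therefore tends to \<open>L\<close> times the mean jump.
\<close>

lemma eventually_le_window:
  assumes "0 < e"
  shows "eventually (\<lambda>s. A s \<le> window 0 / (LINT x|\<pi>. x) + e) at_top"
proof -
  define U where "U = {c. eventually (\<lambda>s. A s \<le> c) at_top}"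
  define L where "L = Inf U"
  have "A s \<le> C" "- C \<le> A s" for s using A_bound[of s] by auto
  then have "C \<in> U" by (simp add: U_def)
  have "- C \<le> c" if "c \<in> U" for c
  proof -
    from that obtain s where "A s \<le> c" by (auto simp: U_def eventually_at_top_linorder)
    then show ?thesis using \<open>- C \<le> A s\<close> by linarith
  qed
  then have bdd: "bdd_below U" by (rule bdd_belowI)
  have upper: "eventually (\<lambda>s. A s \<le> L + e) at_top" if "0 < e" for e
  proof -
    have "\<exists>c\<in>U. c < L + e"
      using \<open>C \<in> U\<close> bdd that unfolding L_def by (subst cInf_less_iff[symmetric]) auto
    then obtain c where c: "eventually (\<lambda>s. A s \<le> c) at_top" "c < L + e" by (auto simp: U_def)
    from c(1) show ?thesis by eventually_elim (use c(2) in linarith)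
  qed
  have "\<exists>s\<ge>real n. L - 1 / Suc n < A s" for n :: nat
  proof (rule ccontr)
    assume "\<not> ?thesis"
    then have "L - 1 / Suc n \<in> U"
      by (auto simp: U_def eventually_at_top_linorder not_less)
    then have "L \<le> L - 1 / Suc n" unfolding L_def by (rule cInf_lower[OF _ bdd])
    then show False by simp
  qed
  then obtain t :: "nat \<Rightarrow> real" where t: "\<And>n. real n \<le> t n" "\<And>n. L - 1 / Suc n < A (t n)"
    by metis
  have t_top: "filterlim t at_top sequentially"
    by (rule filterlim_at_top_mono[OF filterlim_real_sequentially]) (simp add: t)
  have lim: "(\<lambda>n. A (t n)) \<longlonglongrightarrow> L"
  proof (rule order_tendstoI)
    fix c assume "L < c"
    then have "eventually (\<lambda>s. A s \<le> L + (c - L) / 2) at_top" by (intro upper) simp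
    then have "eventually (\<lambda>n. A (t n) \<le> L + (c - L) / 2) sequentially"
      using t_top by (rule eventually_compose_filterlim)
    then show "eventually (\<lambda>n. A (t n) < c) sequentially"
      by eventually_elim (use \<open>L < c\<close> in \<open>simp add: field_simps\<close>)
  next
    fix c assume "c < L"
    have "(\<lambda>n. L - 1 / real (Suc n)) \<longlonglongrightarrow> L - 0"
      by (intro tendsto_intros LIMSEQ_Suc[OF lim_1_over_n])
    then have "eventually (\<lambda>n. c < L - 1 / real (Suc n)) sequentially"
      using \<open>c < L\<close> by (intro order_tendstoD) auto
    then show "eventually (\<lambda>n. c < A (t n)) sequentially"
      by eventually_elim (use t(2) in \<open>force intro: less_trans\<close>)
  qed
  \<comment> \<open>After \<open>k\<close> jumps the reachable shifts \<open>[k a, k b]\<close> form an interval longer than any single jump.\<close>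
  obtain k :: nat where k: "b < real k * (b - a)"
    using reals_Archimedean3[of "b - a"] a_less_b by auto
  define t' where "t' = (\<lambda>n. t n - real k * a)"
  have "(\<lambda>n. A (t' n - s)) \<longlonglongrightarrow> L" if "s \<in> {0..b}" for s
  proof -
    have "(\<lambda>n. A (t n - (real k * a + s))) \<longlonglongrightarrow> L"
      using that k by (intro limsup_propagates[where k = k, OF t_top upper lim]) (auto simp: algebra_simps)
    then show ?thesis by (simp add: t'_def algebra_simps)
  qed
  then have "(\<lambda>n. window (t' n)) \<longlonglongrightarrow> L * (LINT x|\<pi>. x)" by (rule window_limit)
  moreover have "eventually (\<lambda>n. window (t' n) = window 0) sequentially"
  proof -
    have "eventually (\<lambda>n. real k * a \<le> t n) sequentially"
      using t_top by (auto simp: filterlim_at_top)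
    then show ?thesis by eventually_elim (rule window_const, simp add: t'_def)
  qed
  ultimately have "(\<lambda>n. window 0) \<longlonglongrightarrow> L * (LINT x|\<pi>. x)"
    by (rule Lim_transform_eventually)
  then have "window 0 = L * (LINT x|\<pi>. x)"
    by (simp add: LIMSEQ_const_iff)
  then have "L = window 0 / (LINT x|\<pi>. x)" using mean_pos by simp
  then show ?thesis using upper[OF assms] by simp
qed

end

text \<open>
  The equation and its conserved quantity are linear, so the upper bound for \<open>- A\<close> is the lower bound
  for \<open>A\<close>.
\<close>

lemma (in renewal) renewal_limit:
  "(A \<longlongrightarrow> window 0 / (LINT x|\<pi>. x)) at_top"
proof -
  interpret neg: renewal \<pi> a b C \<rho> "\<lambda>t. - A t"
    by unfold_locales
      (auto simp: a_pos a_less_b density[symmetric] \<rho>_cont \<rho>_nonneg \<rho>_outside charged A_bound A_renewal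
        simp del: atLeastAtMost_iff)
  have "neg.A_integral c d = - A_integral c d" for c d
  proof -
    have "(\<lambda>s. if c < s \<and> s \<le> d then - A s else 0) = (\<lambda>s. - (if c < s \<and> s \<le> d then A s else 0))"
      by auto
    then show ?thesis
      unfolding neg.A_integral_def A_integral_def by (simp only: Bochner_Integration.integral_minus)
  qed
  then have w: "neg.window 0 = - window 0"
    unfolding neg.window_def window_def by simp
  define l where "l = window 0 / (LINT x|\<pi>. x)"
  have "(A \<longlongrightarrow> l) at_top"
  proof (rule tendstoI)
    fix e :: real assume "0 < e"
    then have e2: "0 < e / 2" by simp
    have "eventually (\<lambda>s. - A s \<le> - l + e / 2) at_top"
      using neg.eventually_le_window[OF e2] w by (simp add: l_def)
    moreover have "eventually (\<lambda>s. A s \<le> l + e / 2) at_top"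
      using eventually_le_window[OF e2] by (simp add: l_def)
    ultimately show "eventually (\<lambda>s. dist (A s) l < e) at_top"
      by eventually_elim (use \<open>0 < e\<close> in \<open>auto simp: dist_real_def abs_less_iff field_simps\<close>)
  qed
  then show ?thesis by (simp add: l_def)
qed

section \<open>Orthogonal innovations and lattice times\<close>

lemma AE_tendsto_0_if_summable_second_moments:
  fixes Z :: "nat \<Rightarrow> 'w \<Rightarrow> real"
  assumes int: "\<And>k. integrable M (\<lambda>\<omega>. (Z k \<omega>)\<^sup>2)"
    and bound: "\<And>k. (LINT \<omega>|M. (Z k \<omega>)\<^sup>2) \<le> c k" and c: "summable c"
  shows "AE \<omega> in M. (\<lambda>k. Z k \<omega>) \<longlonglongrightarrow> 0"
proof -
  have c0: "0 \<le> c k" for k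
    by (rule order_trans[OF Bochner_Integration.integral_nonneg bound]) simp
  have [measurable]: "(\<lambda>\<omega>. (Z k \<omega>)\<^sup>2) \<in> borel_measurable M" for k
    using int by (rule borel_measurable_integrable)
  have "(\<integral>\<^sup>+\<omega>. (\<Sum>k. ennreal ((Z k \<omega>)\<^sup>2)) \<partial>M) = (\<Sum>k. \<integral>\<^sup>+\<omega>. ennreal ((Z k \<omega>)\<^sup>2) \<partial>M)"
    by (rule nn_integral_suminf) measurable
  also have "\<dots> = (\<Sum>k. ennreal (LINT \<omega>|M. (Z k \<omega>)\<^sup>2))"
    by (intro suminf_cong nn_integral_eq_integral int) auto
  also have "\<dots> \<le> (\<Sum>k. ennreal (c k))"
    by (intro suminf_le ennreal_leI bound) auto
  also have "\<dots> = ennreal (\<Sum>k. c k)" by (rule suminf_ennreal2[OF c0 c])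
  finally have "(\<integral>\<^sup>+\<omega>. (\<Sum>k. ennreal ((Z k \<omega>)\<^sup>2)) \<partial>M) \<noteq> \<infinity>" by (auto simp: top_unique)
  then have "AE \<omega> in M. (\<Sum>k. ennreal ((Z k \<omega>)\<^sup>2)) \<noteq> \<infinity>"
    by (intro nn_integral_noteq_infinite) measurable
  then show ?thesis
  proof eventually_elim
    case (elim \<omega>)
    then have "summable (\<lambda>k. (Z k \<omega>)\<^sup>2)" by (intro summable_suminf_not_top) simp_all
    then have "(\<lambda>k. (Z k \<omega>)\<^sup>2) \<longlonglongrightarrow> 0" by (rule summable_LIMSEQ_zero)
    then have "(\<lambda>k. sqrt ((Z k \<omega>)\<^sup>2)) \<longlonglongrightarrow> sqrt 0" by (rule tendsto_real_sqrt)
    then show ?case by (simp add: tendsto_rabs_zero_iff)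
  qed
qed

abbreviation seq_space :: "(nat \<Rightarrow> real) measure" where
  "seq_space \<equiv> \<Pi>\<^sub>M i\<in>UNIV. borel"

abbreviation env_space :: "(vertex \<Rightarrow> nat \<Rightarrow> real) measure" where
  "env_space \<equiv> \<Pi>\<^sub>M u\<in>UNIV. seq_space"

lemma env_component_measurable:
  "(\<lambda>r. r u i) \<in> borel_measurable env_space"
proof -
  have "(\<lambda>r. r u) \<in> measurable env_space seq_space"
    by (rule measurable_component_singleton) simp
  from measurable_compose[OF this measurable_component_singleton[of i UNIV "\<lambda>_. borel"]]
  show ?thesis by simp
qed

lemma frag_size_measurable [measurable]:
  "(\<lambda>r. frag_size r u) \<in> borel_measurable env_space"
  by (induction u) (auto intro!: borel_measurable_times env_component_measurable)

lemma innovation_measurable [measurable]: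
  assumes [measurable]: "A \<in> borel_measurable borel"
  shows "(\<lambda>r. innovation N T A r u) \<in> borel_measurable env_space"
proof -
  note [measurable] = env_component_measurable
  show ?thesis unfolding innovation_def by measurable
qed

text \<open>
  The size of \<open>v\<close> depends only on the splittings at proper ancestors of \<open>v\<close>, all of which are strictly
  shorter than \<open>v\<close>.
\<close>

lemma frag_size_cong:
  assumes "\<And>w. w \<noteq> u \<Longrightarrow> r w = r' w" and "length v \<le> length u"
  shows "frag_size r v = frag_size r' v"
  using assms(2)
proof (induction v)
  case (Cons i w)
  then have "w \<noteq> u" by auto
  then show ?case using Cons assms(1) by simp
qed simp

lemma innovation_cong:
  assumes "\<And>w. w \<noteq> u \<Longrightarrow> r w = r' w" and "length v \<le> length u" and "v \<noteq> u"
  shows "innovation N T A r v = innovation N T A r' v"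
  using frag_size_cong[of u r r' v] assms by (simp add: innovation_def)

text \<open>
  The bounds on the ratios hold for every outcome, and only independence and the expectation formula
  for one splitting are kept from the law of the ratios. This formula identifies \<open>\<pi>\<close> as the law of
  minus the logarithm of a size-biased ratio.
\<close>

locale fragmentation = prob_space M
  for M :: "'w measure" +
  fixes R :: "vertex \<Rightarrow> 'w \<Rightarrow> nat \<Rightarrow> real" and N :: nat and a b :: real and \<pi> :: "real measure"
  assumes splitting: "bounded_splitting N a b (\<lambda>u. R u \<omega>)"
    and indep: "indep_vars (\<lambda>_. seq_space) R UNIV"
    and many_to_one: "h \<in> borel_measurable borel \<Longrightarrow> (\<And>x. \<bar>h x\<bar> \<le> D) \<Longrightarrow>
      (LINT \<omega>|M. (\<Sum>i<N. R u \<omega> i * h (R u \<omega> i))) = (LINT x|\<pi>. h (exp (- x)))"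
begin

abbreviation env :: "'w \<Rightarrow> vertex \<Rightarrow> nat \<Rightarrow> real" where
  "env \<omega> \<equiv> \<lambda>u. R u \<omega>"

lemma R_measurable [measurable]: "R u \<in> measurable M seq_space"
  using indep by (auto simp: indep_vars_def)

lemma env_measurable [measurable]: "env \<in> measurable M env_space"
  by (rule measurable_PiM_single') (auto simp: space_PiM)

lemma R_component_measurable [measurable]: "(\<lambda>\<omega>. R u \<omega> i) \<in> borel_measurable M"
  using measurable_compose[OF env_measurable env_component_measurable] by simp

lemma a_pos: "0 < a" and a_less_b: "a < b"
  using bounded_splitting.a_pos[OF splitting] bounded_splitting.a_less_b[OF splitting] by auto

end

locale fragmentation_renewal = fragmentation M R N a b \<pi>
  for M :: "'w measure" and R N a b \<pi> +
  fixes A :: "real \<Rightarrow> real" and C :: real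
  assumes A_meas [measurable]: "A \<in> borel_measurable borel"
    and A_bound: "\<bar>A t\<bar> \<le> C"
    and A_renewal: "0 \<le> t \<Longrightarrow> A t = (LINT x|\<pi>. A (t - x))"
begin

lemma C_nonneg: "0 \<le> C"
  using A_bound[of 0] by linarith

text \<open>
  The renewal equation says exactly that splitting an active fragment does not change its expected
  contribution.
\<close>

lemma one_step_mean:
  assumes "exp (- T) \<le> z"
  shows "(LINT \<omega>|M. (\<Sum>i<N. R u \<omega> i * A (T + ln (R u \<omega> i * z)))) = A (T + ln z)"
proof -
  have z: "0 < z" using assms exp_gt_zero[of "- T"] by linarith
  have "- T \<le> ln z" using assms z by (simp add: ln_ge_iff)
  then have "A (T + ln z) = (LINT x|\<pi>. A (T + ln z - x))" by (intro A_renewal) simp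
  also have "\<dots> = (LINT x|\<pi>. A (T + ln (exp (- x) * z)))"
    using z by (intro Bochner_Integration.integral_cong refl arg_cong[where f = A]) (simp add: ln_mult)
  also have "\<dots> = (LINT \<omega>|M. (\<Sum>i<N. R u \<omega> i * A (T + ln (R u \<omega> i * z))))"
    by (rule many_to_one[symmetric, where D = C and h = "\<lambda>x. A (T + ln (x * z))"]) (auto simp: A_bound)
  finally show ?thesis by simp
qed

lemma step_integrable: "integrable M (\<lambda>\<omega>. \<Sum>i<N. R u \<omega> i * A (T + ln (R u \<omega> i * z)))"
proof (intro Bochner_Integration.integrable_sum integrable_const_bound[where B = C] AE_I2)
  fix i \<omega>
  interpret bounded_splitting N a b "env \<omega>" by (rule splitting)
  have "\<bar>R u \<omega> i\<bar> * \<bar>A (T + ln (R u \<omega> i * z))\<bar> \<le> 1 * C"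
    using ratio_nonneg ratio_le_1 A_bound by (intro mult_mono) auto
  then show "norm (R u \<omega> i * A (T + ln (R u \<omega> i * z))) \<le> C" by (simp add: abs_mult)
qed measurable

abbreviation Y :: "real \<Rightarrow> vertex \<Rightarrow> 'w \<Rightarrow> real" where
  "Y T u \<omega> \<equiv> innovation N T A (env \<omega>) u"

lemma Y_measurable: "Y T u \<in> borel_measurable M"
  using measurable_compose[OF env_measurable innovation_measurable[OF A_meas]] by simp

lemma Y_bound: "\<bar>Y T u \<omega>\<bar> \<le> 2 * C * frag_size (env \<omega>) u"
  by (rule bounded_splitting.innovation_bound[OF splitting A_bound])

lemma Y_bound_const: "\<bar>Y T u \<omega>\<bar> \<le> 2 * C"
proof -
  have "2 * C * frag_size (env \<omega>) u \<le> 2 * C * 1"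
    using C_nonneg bounded_splitting.size_le_1[OF splitting] by (intro mult_left_mono) auto
  then show ?thesis using Y_bound[where T = T and u = u and \<omega> = \<omega>] by linarith
qed

lemma Y_product_integrable: "integrable M (\<lambda>\<omega>. Y T u \<omega> * Y T v \<omega>)"
proof (rule integrable_const_bound[where B = "2 * C * (2 * C)"])
  have "\<bar>Y T u \<omega>\<bar> * \<bar>Y T v \<omega>\<bar> \<le> 2 * C * (2 * C)" for \<omega>
    using C_nonneg by (intro mult_mono Y_bound_const) simp_all
  then show "AE \<omega> in M. norm (Y T u \<omega> * Y T v \<omega>) \<le> 2 * C * (2 * C)"
    by (simp add: abs_mult)
qed (rule borel_measurable_times[OF Y_measurable Y_measurable])

text \<open>
  When \<open>u\<close> is the longer vertex, the size of \<open>u\<close> and the whole innovation at \<open>v\<close> are functions of the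
  splittings away from \<open>u\<close>. Integrating out the splitting at \<open>u\<close> first gives \<open>0\<close>.
\<close>

lemma Y_orthogonal_aux:
  assumes "u \<noteq> v" and "length v \<le> length u"
  shows "(LINT \<omega>|M. Y T u \<omega> * Y T v \<omega>) = 0"
proof -
  let ?P1 = "PiM {u} (\<lambda>_. seq_space)" and ?P2 = "PiM (UNIV - {u}) (\<lambda>_. seq_space)"
  let ?X1 = "\<lambda>\<omega>. restrict (env \<omega>) {u}" and ?X2 = "\<lambda>\<omega>. restrict (env \<omega>) (UNIV - {u})"
  let ?m = "merge {u} (UNIV - {u})"
  let ?F = "\<lambda>r. innovation N T A r u * innovation N T A r v"
  have ind: "indep_var ?P1 ?X1 ?P2 ?X2"
    using indep_var_restrict[OF indep, of "{u}" "UNIV - {u}"] by simp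
  have X1: "?X1 \<in> measurable M ?P1" and X2: "?X2 \<in> measurable M ?P2"
    using indep_var_rv1[OF ind] indep_var_rv2[OF ind] by auto
  interpret D1: prob_space "distr M ?P1 ?X1" by (rule prob_space_distr[OF X1])
  interpret D2: prob_space "distr M ?P2 ?X2" by (rule prob_space_distr[OF X2])
  interpret D: pair_prob_space "distr M ?P1 ?X1" "distr M ?P2 ?X2" ..
  have merge: "?m \<in> measurable (?P1 \<Otimes>\<^sub>M ?P2) env_space"
    using measurable_merge[of "{u}" "UNIV - {u}" "\<lambda>_. seq_space"] by (simp add: insert_is_Un[symmetric])
  have F: "?F \<in> borel_measurable env_space"
    by (rule borel_measurable_times[OF innovation_measurable[OF A_meas] innovation_measurable[OF A_meas]])
  have Fm: "(\<lambda>p. ?F (?m p)) \<in> borel_measurable (?P1 \<Otimes>\<^sub>M ?P2)"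
    by (rule measurable_compose[OF merge F])
  have X12: "(\<lambda>\<omega>. (?X1 \<omega>, ?X2 \<omega>)) \<in> measurable M (?P1 \<Otimes>\<^sub>M ?P2)"
    by (rule measurable_Pair[OF X1 X2])
  have split: "?m (?X1 \<omega>, ?X2 \<omega>) = env \<omega>" for \<omega>
    by (auto simp: merge_def fun_eq_iff)
  have joint: "distr M ?P1 ?X1 \<Otimes>\<^sub>M distr M ?P2 ?X2 = distr M (?P1 \<Otimes>\<^sub>M ?P2) (\<lambda>\<omega>. (?X1 \<omega>, ?X2 \<omega>))"
    using indep_var_distribution_eq[of ?P1 ?X1 ?P2 ?X2] ind by simp
  have int: "integrable (distr M ?P1 ?X1 \<Otimes>\<^sub>M distr M ?P2 ?X2) (\<lambda>(x, y). ?F (?m (x, y)))"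
    unfolding joint case_prod_beta' prod.collapse
  proof (subst integrable_distr_eq[OF X12 Fm])
    show "integrable M (\<lambda>\<omega>. ?F (?m (?X1 \<omega>, ?X2 \<omega>)))"
      unfolding split by (rule Y_product_integrable)
  qed
  have inner: "(LINT x|distr M ?P1 ?X1. ?F (?m (x, y))) = 0" if y: "y \<in> space ?P2" for y
  proof -
    have m2: "(\<lambda>x. ?F (?m (x, y))) \<in> borel_measurable ?P1"
      using measurable_compose[OF measurable_Pair2'[OF y] Fm] .
    \<comment> \<open>Neither value depends on the splitting at \<open>u\<close>, so a dummy can be inserted there.\<close>
    define z where "z = frag_size (?m (undefined, y)) u"
    define c where "c = innovation N T A (?m (undefined, y)) v"
    have sz: "frag_size (?m (x, y)) u = z" for x
      unfolding z_def by (rule frag_size_cong[of u]) (auto simp: merge_def fun_eq_iff)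
    have iv: "innovation N T A (?m (x, y)) v = c" for x
      unfolding c_def by (rule innovation_cong[of u]) (use assms in \<open>auto simp: merge_def fun_eq_iff\<close>)
    have "(LINT x|distr M ?P1 ?X1. ?F (?m (x, y))) = (LINT \<omega>|M. ?F (?m (?X1 \<omega>, y)))"
      by (rule integral_distr[OF X1 m2])
    also have "\<dots> = (LINT \<omega>|M. (if exp (- T) \<le> z then z *
         ((\<Sum>i<N. R u \<omega> i * A (T + ln (R u \<omega> i * z))) - A (T + ln z)) else 0) * c)"
    proof (intro Bochner_Integration.integral_cong refl)
      fix \<omega>
      have "?m (?X1 \<omega>, y) u i = R u \<omega> i" for i by (simp add: merge_def)
      then have "innovation N T A (?m (?X1 \<omega>, y)) u = (if exp (- T) \<le> z then z *
         ((\<Sum>i<N. R u \<omega> i * A (T + ln (R u \<omega> i * z))) - A (T + ln z)) else 0)"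
        by (simp add: innovation_def sz)
      then show "?F (?m (?X1 \<omega>, y)) = (if exp (- T) \<le> z then z *
         ((\<Sum>i<N. R u \<omega> i * A (T + ln (R u \<omega> i * z))) - A (T + ln z)) else 0) * c"
        by (simp add: iv)
    qed
    also have "\<dots> = 0"
    proof (cases "exp (- T) \<le> z")
      case True
      have "(LINT \<omega>|M. (\<Sum>i<N. R u \<omega> i * A (T + ln (R u \<omega> i * z))) - A (T + ln z)) = 0"
        using one_step_mean[OF True, of u] step_integrable[of u T z]
        by (subst Bochner_Integration.integral_diff) (auto simp: prob_space)
      then show ?thesis using True by simp
    qed simp
    finally show ?thesis .
  qed
  have "(LINT \<omega>|M. Y T u \<omega> * Y T v \<omega>) = (LINT \<omega>|M. ?F (?m (?X1 \<omega>, ?X2 \<omega>)))"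
    by (simp only: split)
  also have "\<dots> = (LINT p|(distr M ?P1 ?X1 \<Otimes>\<^sub>M distr M ?P2 ?X2). ?F (?m p))"
    unfolding joint by (rule integral_distr[symmetric, OF X12 Fm])
  also have "\<dots> = (LINT y|distr M ?P2 ?X2. LINT x|distr M ?P1 ?X1. ?F (?m (x, y)))"
    using D.integral_snd[OF int] by (simp add: split_def)
  also have "\<dots> = (LINT y|distr M ?P2 ?X2. 0)"
    by (intro Bochner_Integration.integral_cong refl inner) simp
  finally show ?thesis by simp
qed

lemma Y_orthogonal:
  assumes "u \<noteq> v"
  shows "(LINT \<omega>|M. Y T u \<omega> * Y T v \<omega>) = 0"
  using Y_orthogonal_aux[of u v T] Y_orthogonal_aux[of v u T] assms
  by (cases "length v \<le> length u") (auto simp: mult.commute)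

lemma sum_square_eq:
  assumes "finite V"
  shows "(LINT \<omega>|M. (\<Sum>u\<in>V. Y T u \<omega>)\<^sup>2) = (\<Sum>u\<in>V. LINT \<omega>|M. (Y T u \<omega>)\<^sup>2)"
proof -
  have "(LINT \<omega>|M. (\<Sum>u\<in>V. Y T u \<omega>)\<^sup>2) = (\<Sum>u\<in>V. \<Sum>v\<in>V. LINT \<omega>|M. Y T u \<omega> * Y T v \<omega>)"
    unfolding power2_eq_square sum_product
    using Y_product_integrable by (subst Bochner_Integration.integral_sum, simp)+ simp
  also have "\<dots> = (\<Sum>u\<in>V. \<Sum>v\<in>V. if v = u then LINT \<omega>|M. (Y T u \<omega>)\<^sup>2 else 0)"
    by (intro sum.cong refl) (auto simp: Y_orthogonal power2_eq_square)
  finally show ?thesis using assms by simp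
qed

definition remainder :: "real \<Rightarrow> nat \<Rightarrow> nat \<Rightarrow> 'w \<Rightarrow> real" where
  "remainder T n m \<omega> = (\<Sum>k\<in>{n..<m}. \<Sum>u\<in>generation N k. Y T u \<omega>)"

lemma remainder_eq: "remainder T n m \<omega> = (\<Sum>u\<in>(\<Union>k\<in>{n..<m}. generation N k). Y T u \<omega>)"
  unfolding remainder_def
  by (rule sum.UNION_disjoint[symmetric]) (simp, simp, auto simp: generation_def)

lemma remainder_square_integrable: "integrable M (\<lambda>\<omega>. (remainder T n m \<omega>)\<^sup>2)"
  unfolding remainder_eq power2_eq_square sum_product
  by (intro Bochner_Integration.integrable_sum Y_product_integrable)

lemma remainder_second_moment:
  "(LINT \<omega>|M. (remainder T n m \<omega>)\<^sup>2) \<le> (2 * C)\<^sup>2 / (1 - exp (- a)) * exp (- a) ^ n"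
proof -
  have q: "0 < exp (- a)" "exp (- a) < 1" using a_pos by auto
  have "(LINT \<omega>|M. (remainder T n m \<omega>)\<^sup>2) = (\<Sum>k\<in>{n..<m}. \<Sum>u\<in>generation N k. LINT \<omega>|M. (Y T u \<omega>)\<^sup>2)"
    unfolding remainder_eq
    by (subst sum_square_eq, simp) (rule sum.UNION_disjoint, simp, simp, auto simp: generation_def)
  also have "\<dots> = (\<Sum>k\<in>{n..<m}. LINT \<omega>|M. (\<Sum>u\<in>generation N k. (Y T u \<omega>)\<^sup>2))"
    using Y_product_integrable
    by (intro sum.cong refl Bochner_Integration.integral_sum[symmetric]) (simp add: power2_eq_square)
  also have "\<dots> \<le> (\<Sum>k\<in>{n..<m}. LINT \<omega>|M. (2 * C)\<^sup>2 * exp (- a) ^ k)"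
  proof (intro sum_mono integral_mono)
    fix k \<omega>
    interpret bounded_splitting N a b "env \<omega>" by (rule splitting)
    have "(\<Sum>u\<in>generation N k. (Y T u \<omega>)\<^sup>2) \<le> (\<Sum>u\<in>generation N k. (2 * C)\<^sup>2 * (frag_size (env \<omega>) u)\<^sup>2)"
    proof (rule sum_mono)
      fix u
      have "\<bar>Y T u \<omega>\<bar>\<^sup>2 \<le> (2 * C * frag_size (env \<omega>) u)\<^sup>2"
        using Y_bound by (intro power_mono) auto
      then show "(Y T u \<omega>)\<^sup>2 \<le> (2 * C)\<^sup>2 * (frag_size (env \<omega>) u)\<^sup>2"
        by (simp add: power_mult_distrib)
    qed
    also have "\<dots> \<le> (2 * C)\<^sup>2 * exp (- (a * k))"
      unfolding sum_distrib_left[symmetric]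
      using generation_sum_squares[of k] by (intro mult_left_mono) auto
    also have "exp (- (a * k)) = exp (- a) ^ k"
      by (simp add: exp_of_nat_mult[symmetric] mult.commute)
    finally show "(\<Sum>u\<in>generation N k. (Y T u \<omega>)\<^sup>2) \<le> (2 * C)\<^sup>2 * exp (- a) ^ k" .
  qed (auto intro!: Bochner_Integration.integrable_sum simp: power2_eq_square Y_product_integrable)
  also have "\<dots> = (2 * C)\<^sup>2 * (\<Sum>k\<in>{n..<m}. exp (- a) ^ k)"
    by (simp add: prob_space sum_distrib_left)
  also have "\<dots> \<le> (2 * C)\<^sup>2 * (exp (- a) ^ n / (1 - exp (- a)))"
  proof (intro mult_left_mono)
    show "(\<Sum>k\<in>{n..<m}. exp (- a) ^ k) \<le> exp (- a) ^ n / (1 - exp (- a))"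
    proof (cases "n < m")
      case True
      then have "(\<Sum>k\<in>{n..<m}. exp (- a) ^ k) = (exp (- a) ^ n - exp (- a) ^ m) / (1 - exp (- a))"
        using sum_gp_multiplied[of n "m - 1" "exp (- a)"] q
        by (simp add: atLeastLessThanSuc_atLeastAtMost[symmetric] field_simps)
      also have "\<dots> \<le> exp (- a) ^ n / (1 - exp (- a))"
        using q by (intro divide_right_mono) auto
      finally show ?thesis .
    qed (use q in simp)
  qed simp
  finally show ?thesis by simp
qed

text \<open>
  Generation \<open>n\<close> is chosen near \<open>T / (2 b)\<close>: small enough that its fragments are at logarithmic
  distance at least \<open>T / 2\<close> from the threshold, where \<open>A\<close> is close to its limit, and large enough
  that the second moments of the remainders decay geometrically along the lattice.
\<close>

lemma lattice_convergence:
  assumes lim: "(A \<longlongrightarrow> l) at_top" and d: "0 < d"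
    and past: "\<And>t. t < 0 \<Longrightarrow> A t = f (exp t)"
  shows "AE \<omega> in M. (\<lambda>k. gamma_T (frag_size (env \<omega>)) (real k * d) f) \<longlonglongrightarrow> l"
proof -
  have b: "0 < b" using a_pos a_less_b by simp
  define T where "T = (\<lambda>k. real k * d)"
  define n where "n = (\<lambda>k. nat \<lfloor>T k / (2 * b)\<rfloor>)"
  define m where "m = (\<lambda>k. n k + nat \<lceil>T k / a\<rceil> + 1)"
  have T0: "0 \<le> T k" for k using d by (simp add: T_def)
  have n_upper: "real (n k) \<le> T k / (2 * b)" for k
    using T0 b unfolding n_def by (intro of_nat_floor) simp
  have n_lower: "T k / (2 * b) - 1 \<le> real (n k)" for k
    unfolding n_def by linarith
  have bn: "b * real (n k) \<le> T k / 2" for k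
    using n_upper[of k] b by (simp add: field_simps)
  have am: "T k < a * real (m k)" for k
  proof -
    have "T k / a < real (m k)" unfolding m_def by linarith
    then show ?thesis using a_pos by (simp add: field_simps)
  qed
  define q where "q = exp (- (a * d / (2 * b)))"
  have q: "0 < q" "q < 1" using a_pos d b by (auto simp: q_def)
  define K where "K = (2 * C)\<^sup>2 / (1 - exp (- a))"
  have K: "0 \<le> K" using a_pos by (simp add: K_def)
  have "AE \<omega> in M. (\<lambda>k. remainder (T k) (n k) (m k) \<omega>) \<longlonglongrightarrow> 0"
  proof (rule AE_tendsto_0_if_summable_second_moments[OF remainder_square_integrable])
    show "summable (\<lambda>k. K * exp a * q ^ k)"
      using q by (intro summable_mult summable_geometric) auto
    fix k
    have "exp (- a) ^ n k = exp (- (a * real (n k)))"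
      by (simp add: exp_of_nat_mult[symmetric] mult.commute)
    also have "\<dots> \<le> exp (a + real k * - (a * d / (2 * b)))"
      using mult_left_mono[OF n_lower[of k], of a] a_pos by (simp add: T_def algebra_simps)
    also have "\<dots> = exp a * q ^ k" by (simp only: q_def exp_of_nat_mult exp_add)
    finally have "exp (- a) ^ n k \<le> exp a * q ^ k" .
    from mult_left_mono[OF this K]
    show "(LINT \<omega>|M. (remainder (T k) (n k) (m k) \<omega>)\<^sup>2) \<le> K * exp a * q ^ k"
      using remainder_second_moment[of "T k" "n k" "m k"] by (simp add: K_def mult.assoc)
  qed
  then show ?thesis
  proof eventually_elim
    case (elim \<omega>)
    interpret bounded_splitting N a b "env \<omega>" by (rule splitting)
    define W where "W = (\<lambda>k. \<Sum>u\<in>generation N (n k). \<xi> u * A (T k + ln (\<xi> u)))"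
    have gam: "gamma_T \<xi> (T k) f = W k + remainder (T k) (n k) (m k) \<omega>" for k
      unfolding W_def remainder_def
      using bn[of k] am[of k] T0[of k] past by (intro gamma_T_decomposition) (auto simp: m_def)
    have "W \<longlonglongrightarrow> l"
    proof (rule LIMSEQ_I)
      fix e :: real assume "0 < e"
      then have "eventually (\<lambda>t. \<bar>A t - l\<bar> < e / 2) at_top"
        using lim[unfolded tendsto_iff dist_real_def] half_gt_zero by blast
      then obtain t0 where t0: "\<And>t. t0 \<le> t \<Longrightarrow> \<bar>A t - l\<bar> < e / 2"
        by (auto simp: eventually_at_top_linorder)
      obtain k0 :: nat where k0: "2 * t0 < real k0 * d" using reals_Archimedean3[OF d] by blast
      have "norm (W k - l) < e" if "k0 \<le> k" for k
      proof -
        have "real k0 * d \<le> T k" using that d by (simp add: T_def)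
        then have Tk: "t0 \<le> T k / 2" using k0 by simp
        have "W k - l = (\<Sum>u\<in>generation N (n k). \<xi> u * (A (T k + ln (\<xi> u)) - l))"
          using generation_mass[of "n k"]
          by (simp add: W_def right_diff_distrib sum_subtractf sum_distrib_right[symmetric])
        also have "\<bar>\<dots>\<bar> \<le> (\<Sum>u\<in>generation N (n k). \<bar>\<xi> u * (A (T k + ln (\<xi> u)) - l)\<bar>)"
          by (rule sum_abs)
        also have "\<dots> \<le> (\<Sum>u\<in>generation N (n k). \<xi> u * (e / 2))"
        proof (rule sum_mono)
          fix u assume u: "u \<in> generation N (n k)"
          show "\<bar>\<xi> u * (A (T k + ln (\<xi> u)) - l)\<bar> \<le> \<xi> u * (e / 2)"
          proof (cases "\<xi> u = 0")
            case False
            then have "exp (- (b * n k)) \<le> \<xi> u" "0 < \<xi> u"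
              using size_bounds[of u] size_nonneg[of u] u by (auto simp: generation_def)
            then have "- (b * n k) \<le> ln (\<xi> u)" by (simp add: ln_ge_iff)
            then have "t0 \<le> T k + ln (\<xi> u)" using bn[of k] Tk by linarith
            then have "\<bar>A (T k + ln (\<xi> u)) - l\<bar> \<le> e / 2" using t0 by force
            then show ?thesis
              unfolding abs_mult abs_of_nonneg[OF size_nonneg]
              by (rule mult_left_mono[OF _ size_nonneg])
          qed simp
        qed
        also have "\<dots> = e / 2"
          using generation_mass[of "n k"] by (simp add: sum_distrib_right[symmetric] flip: sum_divide_distrib)
        finally show ?thesis using \<open>0 < e\<close> by simp
      qed
      then show "\<exists>no. \<forall>k\<ge>no. norm (W k - l) < e" by blast
    qed
    from tendsto_add[OF this elim] show ?case
      unfolding gam[symmetric] by (simp add: T_def)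
  qed
qed

end

section \<open>From lattice times to all times\<close>

text \<open>
  Exchanging the integrals turns \<open>\<gamma>\<^sub>\<infinity>(f)\<close> into the expected integral of the past
  \<open>t \<mapsto> f (exp t)\<close> over one jump interval \<open>(- Y, 0)\<close>, which is the form of the conserved quantity of the
  renewal equation at time \<open>0\<close>.
\<close>

lemma gamma_infinity_eq:
  fixes \<pi> :: "real measure"
  assumes "prob_space \<pi>" and sets_pi: "sets \<pi> = sets borel"
    and jump: "AE x in \<pi>. 0 \<le> x \<and> x \<le> b"
    and f_cont: "continuous_on UNIV f" and f_bound: "\<And>x. \<bar>f x\<bar> \<le> C"
  shows "gamma_infinity \<pi> f =
    (LINT x|\<pi>. LINT s|lborel. (if - x < s \<and> s < 0 then f (exp s) else 0)) / (LINT x|\<pi>. x)"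
proof -
  interpret prob_space \<pi> by fact
  interpret pair_sigma_finite \<pi> lborel by unfold_locales
  note [measurable_cong] = sets_pi
  have f_meas [measurable]: "f \<in> borel_measurable borel"
    by (rule borel_measurable_continuous_onI[OF f_cont])
  have C: "0 \<le> C" using f_bound[of 0] by linarith
  let ?F = "\<lambda>x s. if 0 \<le> s \<and> s \<le> x then f (exp (s - x)) else (0 :: real)"
  have i: "integrable lborel (?F x)" for x
  proof (rule Bochner_Integration.integrable_bound)
    show "integrable lborel (\<lambda>s. C * indicator {0..x} s)" by simp
  qed (use f_bound C in \<open>auto simp: indicator_def\<close>)
  have int: "integrable (\<pi> \<Otimes>\<^sub>M lborel) (\<lambda>(x, s). ?F x s)"
  proof (rule Fubini_integrable)
    show "(\<lambda>(x, s). ?F x s) \<in> borel_measurable (\<pi> \<Otimes>\<^sub>M lborel)" by measurable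
    show "AE x in \<pi>. integrable lborel (\<lambda>s. case (x, s) of (x, s) \<Rightarrow> ?F x s)" using i by simp
    show "integrable \<pi> (\<lambda>x. LINT s|lborel. norm (case (x, s) of (x, s) \<Rightarrow> ?F x s))"
    proof (rule integrable_const_bound[where B = "C * b"])
      show "AE x in \<pi>. norm (LINT s|lborel. norm (case (x, s) of (x, s) \<Rightarrow> ?F x s)) \<le> C * b"
        using jump
      proof eventually_elim
        case (elim x)
        have "\<bar>LINT s|lborel. \<bar>?F x s\<bar>\<bar> \<le> (LINT s|lborel. C * indicator {0..x} s)"
          using integrable_abs[OF i[of x]]
          by (intro integral_abs_bound_integral)
            (simp, simp, use f_bound C in \<open>auto simp: indicator_def\<close>)
        also have "\<dots> = C * x" using elim by simp
        also have "\<dots> \<le> C * b" using elim C by (intro mult_left_mono) auto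
        finally show ?case by simp
      qed
    qed measurable
  qed
  have "(LINT s:{0..}|lborel. (LINT y|\<pi>. (if 0 \<le> y - s then Phi f (y - s) else 0))) =
      (LINT s|lborel. LINT x|\<pi>. ?F x s)"
    unfolding set_lebesgue_integral_def Phi_def
  proof (rule Bochner_Integration.integral_cong[OF refl])
    fix s
    show "indicator {0..} s *\<^sub>R (LINT y|\<pi>. (if 0 \<le> y - s then f (exp (- (y - s))) else 0)) =
        (LINT x|\<pi>. ?F x s)"
      by (cases "0 \<le> s") (auto simp: intro!: Bochner_Integration.integral_cong)
  qed
  also have "\<dots> = (LINT x|\<pi>. LINT s|lborel. ?F x s)"
    using Fubini_integral[OF int] by simp
  also have "\<dots> = (LINT x|\<pi>. LINT s|lborel. (if - x < s \<and> s < 0 then f (exp s) else 0))"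
  proof (rule Bochner_Integration.integral_cong[OF refl])
    fix x
    have "(LINT s|lborel. ?F x s) = (LINT s|lborel. (if - x \<le> s \<and> s \<le> 0 then f (exp s) else 0))"
      by (subst lborel_integral_real_affine[where t = x and c = 1])
        (auto intro!: Bochner_Integration.integral_cong)
    also have "\<dots> = (LINT s|lborel. (if - x < s \<and> s < 0 then f (exp s) else 0))"
    proof (rule integral_cong_AE)
      show "AE s in lborel. (if - x \<le> s \<and> s \<le> 0 then f (exp s) else 0) =
          (if - x < s \<and> s < 0 then f (exp s) else 0)"
        using AE_lborel_singleton[of "- x"] AE_lborel_singleton[of 0]
        by eventually_elim auto
    qed measurable
    finally show "(LINT s|lborel. ?F x s) = \<dots>" .
  qed
  finally show ?thesis by (simp add: gamma_infinity_def eta_def)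
qed

text \<open>
  A continuous majorant of the indicator of \<open>[exp (- d), 1]\<close> on \<open>[0, 1]\<close>, supported in
  \<open>[exp (- (2 * d)), \<infinity>)\<close>.
\<close>

definition bump :: "real \<Rightarrow> real \<Rightarrow> real" where
  "bump d x = max 0 (min 1 ((x - exp (- (2 * d))) / (exp (- d) - exp (- (2 * d)))))"

lemma
  assumes "0 < d"
  shows bump_continuous: "continuous_on UNIV (bump d)"
    and bump_nonneg: "0 \<le> bump d x" and bump_le_1: "bump d x \<le> 1"
    and bump_eq_1: "exp (- d) \<le> x \<Longrightarrow> bump d x = 1"
    and bump_eq_0: "x \<le> exp (- (2 * d)) \<Longrightarrow> bump d x = 0"
proof -
  have pos: "0 < exp (- d) - exp (- (2 * d))" using assms by simp
  show "continuous_on UNIV (bump d)"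
    unfolding bump_def using pos by (intro continuous_intros) auto
  show "0 \<le> bump d x" "bump d x \<le> 1" by (auto simp: bump_def)
  show "bump d x = 1" if "exp (- d) \<le> x"
  proof -
    have "1 \<le> (x - exp (- (2 * d))) / (exp (- d) - exp (- (2 * d)))"
      using pos that by (simp add: le_divide_eq)
    then show ?thesis by (simp add: bump_def)
  qed
  show "bump d x = 0" if "x \<le> exp (- (2 * d))"
  proof -
    have "(x - exp (- (2 * d))) / (exp (- d) - exp (- (2 * d))) \<le> 0"
      using pos that by (intro divide_nonpos_pos) auto
    then show ?thesis by (simp add: bump_def)
  qed
qed

locale fragmentation_density = fragmentation M R N a b \<pi>
  for M :: "'w measure" and R N a b \<pi> +
  fixes \<rho> :: "real \<Rightarrow> real"
  assumes \<pi>_prob: "prob_space \<pi>"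
    and \<pi>_density: "\<pi> = density lborel (\<lambda>x. ennreal (\<rho> x))"
    and \<rho>_cont: "continuous_on UNIV \<rho>" and \<rho>_nonneg: "0 \<le> \<rho> x"
    and \<rho>_outside: "x \<notin> {a..b} \<Longrightarrow> \<rho> x = 0"
    and charged: "x \<in> {a..b} \<Longrightarrow> 0 < e \<Longrightarrow> 0 < measure \<pi> (ball x e)"
begin

lemma \<pi>_jump: "AE x in \<pi>. x \<in> {a..b}"
proof -
  have "\<rho> \<in> borel_measurable borel" by (rule borel_measurable_continuous_onI[OF \<rho>_cont])
  then show ?thesis
    unfolding \<pi>_density
    by (subst AE_density) (use \<rho>_outside in \<open>force intro!: AE_I2 simp del: atLeastAtMost_iff\<close>)+
qed

lemma sets_\<pi>: "sets \<pi> = sets borel"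
  by (simp add: \<pi>_density)

lemma mean_pos: "0 < (LINT x|\<pi>. x)"
proof -
  \<comment> \<open>The mean concerns the jump law only; the zero solution gives access to it.\<close>
  interpret r: renewal \<pi> a b 0 \<rho> "\<lambda>_. 0"
  proof (rule renewal.intro)
    show "x \<in> {a..b} \<Longrightarrow> 0 < e \<Longrightarrow> 0 < measure \<pi> (ball x e)" for x e by (rule charged)
    show "x \<notin> {a..b} \<Longrightarrow> \<rho> x = 0" for x by (rule \<rho>_outside)
  qed (fact \<pi>_prob a_pos a_less_b \<pi>_density \<rho>_cont \<rho>_nonneg | simp)+
  show ?thesis by (rule r.mean_pos)
qed

text \<open>
  The limit of the renewal function is \<open>\<gamma>\<^sub>\<infinity>(f)\<close>, since its past \<open>t \<mapsto> f (exp t)\<close> determines the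
  conserved quantity.
\<close>

lemma lattice_limit:
  assumes f_cont: "continuous_on UNIV f" and f_bound: "\<And>x. \<bar>f x\<bar> \<le> C" and d: "0 < d"
  shows "AE \<omega> in M. (\<lambda>k. gamma_T (frag_size (env \<omega>)) (real k * d) f) \<longlonglongrightarrow> gamma_infinity \<pi> f"
proof -
  have [measurable]: "f \<in> borel_measurable borel"
    by (rule borel_measurable_continuous_onI[OF f_cont])
  have g: "(\<lambda>t. f (exp t)) \<in> borel_measurable borel" by measurable
  have jump': "AE x in \<pi>. a \<le> x" using \<pi>_jump by eventually_elim simp
  obtain A where A: "A \<in> borel_measurable borel" "\<And>t. \<bar>A t\<bar> \<le> C"
    "\<And>t. t < 0 \<Longrightarrow> A t = f (exp t)" "\<And>t. 0 \<le> t \<Longrightarrow> A t = (LINT x|\<pi>. A (t - x))"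
    by (rule renewal_function_exists[OF \<pi>_prob sets_\<pi> a_pos jump' g f_bound]) (use that in blast)
  interpret r: renewal \<pi> a b C \<rho> A
  proof (rule renewal.intro)
    show "x \<in> {a..b} \<Longrightarrow> 0 < e \<Longrightarrow> 0 < measure \<pi> (ball x e)" for x e by (rule charged)
    show "x \<notin> {a..b} \<Longrightarrow> \<rho> x = 0" for x by (rule \<rho>_outside)
  qed (fact \<pi>_prob a_pos a_less_b \<pi>_density \<rho>_cont \<rho>_nonneg A)+
  interpret f: fragmentation_renewal M R N a b \<pi> A C
    by unfold_locales (fact A)+
  have "gamma_infinity \<pi> f = r.window 0 / (LINT x|\<pi>. x)"
  proof -
    have "AE x in \<pi>. 0 \<le> x \<and> x \<le> b" using \<pi>_jump a_pos by auto
    then have "gamma_infinity \<pi> f = (LINT x|\<pi>. LINT s|lborel.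
        (if - x < s \<and> s < 0 then f (exp s) else 0)) / (LINT x|\<pi>. x)"
      by (rule gamma_infinity_eq[OF \<pi>_prob sets_\<pi> _ f_cont f_bound])
    also have "(LINT x|\<pi>. LINT s|lborel. (if - x < s \<and> s < 0 then f (exp s) else 0)) = r.window 0"
      unfolding r.window_def r.A_integral_def
    proof (rule Bochner_Integration.integral_cong[OF refl])
      fix x
      show "(LINT s|lborel. (if - x < s \<and> s < 0 then f (exp s) else 0)) =
          (LINT s|lborel. (if 0 - x < s \<and> s \<le> 0 then A s else 0))"
      proof (rule integral_cong_AE)
        show "AE s in lborel. (if - x < s \<and> s < 0 then f (exp s) else 0) =
            (if 0 - x < s \<and> s \<le> 0 then A s else 0)"
          using AE_lborel_singleton[of 0] by eventually_elim (auto simp: A(3))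
      qed (use A(1) in measurable)
    qed
    finally show ?thesis .
  qed
  with r.renewal_limit have "(A \<longlongrightarrow> gamma_infinity \<pi> f) at_top" by simp
  then show ?thesis using d A(3) by (rule f.lattice_convergence)
qed

text \<open>
  On the logarithmic scale the bump lives on an interval of length \<open>2 * d\<close>.
\<close>

lemma gamma_infinity_bump:
  assumes "0 < d"
  shows "gamma_infinity \<pi> (bump d) \<le> 2 * d / (LINT x|\<pi>. x)"
proof -
  interpret p: prob_space \<pi> by (rule \<pi>_prob)
  have [measurable]: "bump d \<in> borel_measurable borel"
    by (rule borel_measurable_continuous_onI[OF bump_continuous[OF assms]])
  have jump: "AE x in \<pi>. 0 \<le> x \<and> x \<le> b" using \<pi>_jump a_pos by auto
  have b: "\<bar>bump d x\<bar> \<le> 1" for x using bump_nonneg[OF assms] bump_le_1[OF assms] by simp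
  have inner: "\<bar>LINT s|lborel. (if - x < s \<and> s < 0 then bump d (exp s) else 0)\<bar> \<le> 2 * d" for x
  proof -
    have *: "\<bar>if - x < s \<and> s < 0 then bump d (exp s) else 0\<bar> \<le> indicator {- (2 * d)..0} s" for s
    proof (cases "s < - (2 * d)")
      case True
      then show ?thesis using bump_eq_0[OF assms, of "exp s"] by simp
    qed (use b in \<open>auto simp: indicator_def\<close>)
    have i: "integrable lborel (\<lambda>s. if - x < s \<and> s < 0 then bump d (exp s) else 0)"
      by (rule Bochner_Integration.integrable_bound[of _ "indicator {- (2 * d)..0} :: real \<Rightarrow> real"])
        (use * in auto)
    have "\<bar>LINT s|lborel. (if - x < s \<and> s < 0 then bump d (exp s) else 0)\<bar>
        \<le> (LINT s|lborel. indicator {- (2 * d)..0} s)"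
      by (rule integral_abs_bound_integral[OF i _ *]) simp
    then show ?thesis using assms by simp
  qed
  have "(LINT x|\<pi>. LINT s|lborel. (if - x < s \<and> s < 0 then bump d (exp s) else 0))
      \<le> (LINT x|\<pi>. 2 * d)"
  proof (rule integral_mono_AE)
    have "(\<lambda>x. LINT s|lborel. (if - x < s \<and> s < 0 then bump d (exp s) else 0)) \<in> borel_measurable borel"
      by measurable
    then show "integrable \<pi> (\<lambda>x. LINT s|lborel. (if - x < s \<and> s < 0 then bump d (exp s) else 0))"
      using inner
      by (intro p.integrable_const_bound[where B = "2 * d"]) (auto simp: measurable_cong_sets[OF sets_\<pi> refl])
    show "AE x in \<pi>. (LINT s|lborel. (if - x < s \<and> s < 0 then bump d (exp s) else 0)) \<le> 2 * d"
      using inner by (intro AE_I2) (simp add: abs_le_iff)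
  qed simp
  then have "(LINT x|\<pi>. LINT s|lborel. (if - x < s \<and> s < 0 then bump d (exp s) else 0)) \<le> 2 * d"
    using p.prob_space by simp
  then show ?thesis
    unfolding gamma_infinity_eq[OF \<pi>_prob sets_\<pi> jump bump_continuous[OF assms] b]
    using mean_pos by (intro divide_right_mono) auto
qed

text \<open>
  The lattice limit is used simultaneously for the countably many meshes \<open>1 / (j + 1)\<close>, for \<open>f\<close> and
  for the bump belonging to each mesh. On this event a deterministic comparison fills the gaps.
\<close>

lemma gamma_T_limit:
  assumes f_cont: "continuous_on UNIV f" and f_bound: "\<And>x. \<bar>f x\<bar> \<le> C"
  shows "AE \<omega> in M. ((\<lambda>T. gamma_T (frag_size (env \<omega>)) T f) \<longlongrightarrow> gamma_infinity \<pi> f) at_top"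
proof -
  define mesh where "mesh = (\<lambda>j. 1 / real (Suc j))"
  have mesh: "0 < mesh j" for j by (simp add: mesh_def)
  have mesh0: "mesh \<longlonglongrightarrow> 0"
    unfolding mesh_def by (rule LIMSEQ_Suc[OF lim_1_over_n])
  have bump_bound: "\<bar>bump (mesh j) x\<bar> \<le> 1" for j x
    using bump_nonneg[OF mesh] bump_le_1[OF mesh] by simp
  have "AE \<omega> in M. \<forall>j. (\<lambda>k. gamma_T (frag_size (env \<omega>)) (real k * mesh j) f) \<longlonglongrightarrow> gamma_infinity \<pi> f"
    by (intro AE_all_countable[THEN iffD2] allI lattice_limit[OF f_cont f_bound mesh])
  moreover have "AE \<omega> in M. \<forall>j. (\<lambda>k. gamma_T (frag_size (env \<omega>)) (real k * mesh j) (bump (mesh j)))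
      \<longlonglongrightarrow> gamma_infinity \<pi> (bump (mesh j))"
    by (intro AE_all_countable[THEN iffD2] allI
        lattice_limit[OF bump_continuous[OF mesh] bump_bound mesh])
  ultimately show ?thesis
  proof eventually_elim
    case (elim \<omega>)
    interpret bounded_splitting N a b "env \<omega>" by (rule splitting)
    have C: "0 \<le> C" using f_bound[of 0] by linarith
    let ?l = "gamma_infinity \<pi> f"
    show ?case
    proof (rule tendstoI)
      fix e :: real assume e: "0 < e"
      have "uniformly_continuous_on {0..1} f"
        by (rule compact_uniformly_continuous) (auto intro: continuous_on_subset[OF f_cont])
      then obtain r where r: "0 < r"
        "\<And>x y. x \<in> {0..1} \<Longrightarrow> y \<in> {0..1} \<Longrightarrow> \<bar>x - y\<bar> < r \<Longrightarrow> \<bar>f x - f y\<bar> < e / 4"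
        unfolding uniformly_continuous_on_def dist_real_def using e
        by (metis abs_minus_commute zero_less_divide_iff zero_less_numeral)
      have "(\<lambda>j. 2 * C * (2 * mesh j / (LINT x|\<pi>. x))) \<longlonglongrightarrow> 2 * C * (2 * 0 / (LINT x|\<pi>. x))"
        using mean_pos by (intro tendsto_intros mesh0) auto
      then have "eventually (\<lambda>j. 2 * C * (2 * mesh j / (LINT x|\<pi>. x)) < e / 4) sequentially"
        using e by (intro order_tendstoD(2)) auto
      moreover have "eventually (\<lambda>j. mesh j < r) sequentially"
        using mesh0 r(1) by (rule order_tendstoD(2))
      ultimately have "eventually (\<lambda>j. 2 * C * (2 * mesh j / (LINT x|\<pi>. x)) < e / 4 \<and> mesh j < r) sequentially"
        by eventually_elim simp
      then obtain j where j: "2 * C * (2 * mesh j / (LINT x|\<pi>. x)) < e / 4" "mesh j < r"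
        by (auto simp: eventually_sequentially)
      define d where "d = mesh j"
      have d: "0 < d" using mesh by (simp add: d_def)
      have "2 * C * gamma_infinity \<pi> (bump d) \<le> 2 * C * (2 * d / (LINT x|\<pi>. x))"
        using gamma_infinity_bump[OF d] C by (intro mult_left_mono) auto
      then have "2 * C * gamma_infinity \<pi> (bump d) < e / 4" using j by (simp add: d_def)
      moreover have "(\<lambda>k. 2 * C * gamma_T \<xi> (real k * d) (bump d)) \<longlonglongrightarrow> 2 * C * gamma_infinity \<pi> (bump d)"
        using elim(2) unfolding d_def by (intro tendsto_mult tendsto_const) blast
      ultimately have "eventually (\<lambda>k. 2 * C * gamma_T \<xi> (real k * d) (bump d) < e / 4) sequentially"
        by (intro order_tendstoD(2))
      moreover have "eventually (\<lambda>k. \<bar>gamma_T \<xi> (real k * d) f - ?l\<bar> < e / 4) sequentially"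
        using elim(1) e unfolding d_def tendsto_iff dist_real_def
        by (meson divide_pos_pos zero_less_numeral)
      ultimately have "eventually (\<lambda>k. 2 * C * gamma_T \<xi> (real k * d) (bump d) < e / 4 \<and>
          \<bar>gamma_T \<xi> (real k * d) f - ?l\<bar> < e / 4) sequentially"
        by eventually_elim simp
      then obtain k0 where k0: "\<And>k. k0 \<le> k \<Longrightarrow> 2 * C * gamma_T \<xi> (real k * d) (bump d) < e / 4"
        "\<And>k. k0 \<le> k \<Longrightarrow> \<bar>gamma_T \<xi> (real k * d) f - ?l\<bar> < e / 4"
        by (auto simp: eventually_sequentially)
      have "dist (gamma_T \<xi> T f) ?l < e" if T: "real k0 * d \<le> T" for T
      proof -
        define k where "k = nat \<lfloor>T / d\<rfloor>"
        have "0 \<le> real k0 * d" using d by simp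
        then have T0: "0 \<le> T" using T by linarith
        have "real k \<le> T / d" "T / d \<le> real k + 1"
          using T0 d by (auto simp: k_def)
        then have kT: "real k * d \<le> T" "T \<le> real k * d + d"
          using d by (auto simp: field_simps)
        have "real k0 \<le> T / d" using T d by (simp add: field_simps)
        then have k: "k0 \<le> k" unfolding k_def using le_nat_floor by blast
        have "\<bar>gamma_T \<xi> T f - gamma_T \<xi> (real k * d) f\<bar> \<le>
            e / 4 + 2 * C * gamma_T \<xi> (real k * d) (bump d)"
        proof (rule gamma_T_increment[OF _ kT f_bound])
          fix x y :: real assume "x \<in> {0..1}" "y \<in> {0..1}" "\<bar>x - y\<bar> \<le> d"
          then show "\<bar>f x - f y\<bar> \<le> e / 4" using r(2)[of x y] j(2) by (simp add: d_def)
        qed (use d bump_nonneg[OF d] bump_eq_1[OF d] in auto)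
        then show ?thesis using k0[OF k] e unfolding dist_real_def by linarith
      qed
      then show "eventually (\<lambda>T. dist (gamma_T \<xi> T f) ?l < e) at_top"
        by (auto simp: eventually_at_top_linorder)
    qed
  qed
qed

end

section \<open>Support and density of the size-biased law\<close>

text \<open>
  In a second countable space the null open sets have a null union, by the Lindelof property.
\<close>

lemma AE_in_measure_support:
  fixes \<pi> :: "'a::second_countable_topology measure"
  assumes sets_pi: "sets \<pi> = sets borel"
  shows "AE x in \<pi>. x \<in> measure_support \<pi>"
proof -
  define F where "F = {U. open U \<and> emeasure \<pi> U = 0}"
  obtain F' where F': "F' \<subseteq> F" "countable F'" "\<Union> F' = \<Union> F"
    using Lindelof[of F] by (auto simp: F_def)
  have "(\<Union>U\<in>F'. U) \<in> null_sets \<pi>"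
  proof (rule null_sets_UN'[OF F'(2)])
    show "U \<in> null_sets \<pi>" if "U \<in> F'" for U
      using that F'(1) by (auto simp: F_def null_sets_def sets_pi)
  qed
  moreover have "x \<in> \<Union> F" if "x \<notin> measure_support \<pi>" for x
    using that by (auto simp: measure_support_def F_def)
  ultimately show ?thesis
    using F'(3) by (intro AE_I'[of "\<Union> F'"]) auto
qed

text \<open>
  Where a continuous density is positive it charges every neighbourhood, so it vanishes off the
  support. As the support keeps a distance \<open>a\<close> from \<open>0\<close>, the extension by \<open>0\<close> to the whole line is
  continuous.
\<close>

lemma continuous_density_globally:
  assumes dens: "has_continuous_density \<pi>" and supp: "measure_support \<pi> = {a..b}" and a: "0 < a"
  obtains \<rho> where "continuous_on UNIV \<rho>" "\<And>x. 0 \<le> \<rho> x" "\<And>x. x \<notin> {a..b} \<Longrightarrow> \<rho> x = 0"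
    "\<pi> = density lborel (\<lambda>x. ennreal (\<rho> x))"
proof -
  obtain \<rho>0 where \<rho>0: "continuous_on {0<..} \<rho>0" "\<And>x. 0 < x \<Longrightarrow> 0 \<le> \<rho>0 x"
    "\<pi> = density lborel (\<lambda>x. ennreal (\<rho>0 x) * indicator {0<..} x)"
    using dens by (auto simp: has_continuous_density_def)
  define \<rho> where "\<rho> = (\<lambda>x::real. indicator {0<..} x *\<^sub>R \<rho>0 x)"
  have meas [measurable]: "\<rho> \<in> borel_measurable borel"
    unfolding \<rho>_def by (rule borel_measurable_continuous_on_indicator[OF _ \<rho>0(1)]) simp
  have nonneg: "0 \<le> \<rho> x" for x using \<rho>0(2) by (simp add: \<rho>_def indicator_def)
  have "ennreal (\<rho>0 x) * indicator {0<..} x = ennreal (\<rho> x)" for x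
    by (simp add: \<rho>_def indicator_def)
  then have pi: "\<pi> = density lborel (\<lambda>x. ennreal (\<rho> x))" using \<rho>0(3) by simp
  have outside: "\<rho> x = 0" if "x \<notin> {a..b}" for x
  proof (rule ccontr)
    assume ne: "\<rho> x \<noteq> 0"
    then have x: "0 < x" by (auto simp: \<rho>_def indicator_def split: if_splits)
    have "x \<notin> measure_support \<pi>" using that supp by blast
    then have "\<exists>U. open U \<and> x \<in> U \<and> \<not> 0 < emeasure \<pi> U"
      unfolding measure_support_def by blast
    then obtain U where U: "open U" "x \<in> U" "emeasure \<pi> U = 0"
      by (auto simp: not_gr_zero)
    have "open ({0<..} \<inter> \<rho>0 -` {0<..})"
      by (rule continuous_open_preimage[OF \<rho>0(1)]) auto
    then have "open (U \<inter> ({0<..} \<inter> \<rho>0 -` {0<..}))" using U(1) by (rule open_Int[rotated])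
    moreover have "x \<in> U \<inter> ({0<..} \<inter> \<rho>0 -` {0<..})"
      using U(2) x ne \<rho>0(2)[OF x] by (auto simp: \<rho>_def)
    ultimately obtain e where e: "0 < e" "ball x e \<subseteq> U \<inter> ({0<..} \<inter> \<rho>0 -` {0<..})"
      unfolding open_contains_ball by blast
    have "(\<integral>\<^sup>+y. ennreal (\<rho> y) * indicator U y \<partial>lborel) = 0"
      using U unfolding pi by (subst (asm) emeasure_density) auto
    then have zero: "AE y in lborel. ennreal (\<rho> y) * indicator U y = 0"
      using U(1) by (subst (asm) nn_integral_0_iff_AE) auto
    have "ennreal (\<rho> y) * indicator U y \<noteq> 0" if "y \<in> ball x e" for y
    proof -
      have "y \<in> U" "0 < y" "0 < \<rho>0 y" using that e(2) by blast+
      then show ?thesis by (simp add: \<rho>_def)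
    qed
    then have "AE y in lborel. y \<notin> ball x e" by (intro eventually_mono[OF zero]) blast
    then have "emeasure lborel (ball x e) = 0"
      by (subst (asm) AE_iff_measurable[where N = "ball x e"]) auto
    then show False using e(1) by (simp add: ball_eq_greaterThanLessThan)
  qed
  have "continuous_on ({0<..} \<union> {..<a}) \<rho>"
  proof (rule continuous_on_open_Un)
    show "continuous_on {0<..} \<rho>"
      using \<rho>0(1) by (rule continuous_on_eq) (simp add: \<rho>_def)
    show "continuous_on {..<a} \<rho>"
      by (rule continuous_on_eq[OF continuous_on_const[of _ 0]]) (simp add: outside)
  qed auto
  moreover have "{0<..} \<union> {..<a} = (UNIV :: real set)" using a by auto
  ultimately show ?thesis using that[of \<rho>] nonneg outside pi by simp
qed

section \<open>Dislocations with bounded ratios\<close>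

definition bounded_partition :: "nat \<Rightarrow> real \<Rightarrow> real \<Rightarrow> (nat \<Rightarrow> real) \<Rightarrow> bool" where
  "bounded_partition N a b s \<longleftrightarrow>
     (\<forall>i. s i = 0 \<or> exp (- b) \<le> s i \<and> s i \<le> exp (- a)) \<and> (\<forall>i. N \<le> i \<longrightarrow> s i = 0) \<and>
     (\<Sum>i<N. s i) = 1"

text \<open>
  A nonzero entry at index \<open>N\<close> would force \<open>N\<close> larger ones before it, each at least \<open>exp (- b)\<close>, and
  these would exceed the total mass.
\<close>

lemma bounded_partition_if_large_entries:
  assumes s: "s \<in> mass_partitions" "(\<Sum>i. s i) = 1"
    and entries: "\<And>i. s i = 0 \<or> exp (- b) \<le> s i \<and> s i \<le> exp (- a)"
    and N: "exp b < real N"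
  shows "bounded_partition N a b s"
proof -
  have dec: "\<And>i j. i \<le> j \<Longrightarrow> s j \<le> s i" and nonneg: "\<And>i. 0 \<le> s i" and summ: "summable s"
    using s(1) by (auto simp: mass_partitions_def decseq_def)
  have "s N = 0"
  proof (rule ccontr)
    assume "s N \<noteq> 0"
    then have "exp (- b) \<le> s i" if "i < N" for i
      using entries[of N] dec[of i N] that by linarith
    then have "(\<Sum>i<N. exp (- b)) \<le> (\<Sum>i<N. s i)" by (intro sum_mono) simp
    also have "\<dots> \<le> 1"
      using sum_le_suminf[OF summ, of "{..<N}"] nonneg s(2) by simp
    finally have "real N * exp (- b) \<le> 1" by simp
    moreover have "exp b * exp (- b) < real N * exp (- b)" using N by (intro mult_strict_right_mono) auto
    ultimately show False by (simp flip: exp_add)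
  qed
  then have tail: "s i = 0" if "N \<le> i" for i
    using dec[OF that] nonneg[of i] by simp
  then have "(\<Sum>i. s i) = (\<Sum>i<N. s i)" by (intro suminf_finite) auto
  then show ?thesis using entries tail s(2) by (simp add: bounded_partition_def)
qed

context
  fixes \<nu> :: "(nat \<Rightarrow> real) measure"
  assumes \<nu>: "dislocation_measure \<nu>"
begin

lemma space_dislocation: "space \<nu> = mass_partitions"
proof -
  have "space \<nu> = space mass_partition_space"
    using \<nu> by (intro sets_eq_imp_space_eq) (simp add: dislocation_measure_def)
  then show ?thesis by (simp add: mass_partition_space_def space_restrict_space space_PiM)
qed

lemma prob_space_dislocation: "prob_space \<nu>"
  using \<nu> by (intro prob_spaceI) (simp add: space_dislocation dislocation_measure_def)

lemma dislocation_component: "(\<lambda>s. s i) \<in> borel_measurable \<nu>"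
proof -
  have "(\<lambda>s. s i) \<in> borel_measurable (PiM UNIV (\<lambda>_. borel))"
    by (rule measurable_component_singleton) simp
  then have "(\<lambda>s. s i) \<in> borel_measurable mass_partition_space"
    unfolding mass_partition_space_def by (rule measurable_restrict_space1)
  then show ?thesis
    using \<nu> by (simp add: dislocation_measure_def cong: measurable_cong_sets)
qed

end

context
  fixes \<nu> :: "(nat \<Rightarrow> real) measure" and \<pi> :: "real measure" and a b :: real and N :: nat
  assumes \<nu>: "dislocation_measure \<nu>" and bias: "size_biased_law \<nu> \<pi>"
    and jump: "AE x in \<pi>. x \<in> {a..b}" and N: "exp b < real N"
begin

text \<open>
  Testing the size-biasing identity with the indicator of the positive ratios outside
  \<open>[exp (- b), exp (- a)]\<close> shows that almost surely there are none.
\<close>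

lemma AE_bounded_partition: "AE s in \<nu>. bounded_partition N a b s"
proof -
  interpret prob_space \<nu> by (rule prob_space_dislocation[OF \<nu>])
  note [measurable] = dislocation_component[OF \<nu>]
  have one: "emeasure \<nu> {s \<in> mass_partitions. (\<Sum>i. s i) = 1} = 1"
    using \<nu> by (simp add: dislocation_measure_def)
  then have "{s \<in> mass_partitions. (\<Sum>i. s i) = 1} \<in> sets \<nu>"
    using emeasure_notin_sets by force
  then have 1: "AE s in \<nu>. s \<in> {s \<in> mass_partitions. (\<Sum>i. s i) = 1}"
    using one by (subst AE_in_set_eq_1) (auto simp: emeasure_eq_measure)
  define h where "h = (indicator {x. 0 < x \<and> \<not> (exp (- b) \<le> x \<and> x \<le> exp (- a))} :: real \<Rightarrow> real)"
  have h_meas [measurable]: "h \<in> borel_measurable borel" unfolding h_def by measurable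
  have "bounded (h ` {0..1})"
    by (rule boundedI[of _ 1]) (auto simp: h_def indicator_def)
  then have "(\<integral>\<^sup>+ s. (\<Sum>i. ennreal (s i * h (s i))) \<partial>\<nu>) = (\<integral>\<^sup>+ x. ennreal (h (exp (- x))) \<partial>\<pi>)"
    using bias measurable_restrict_space1[OF h_meas]
    by (simp add: size_biased_law_def h_def)
  also have "\<dots> = (\<integral>\<^sup>+ x. 0 \<partial>\<pi>)"
    using jump by (intro nn_integral_cong_AE) (auto simp: h_def)
  finally have "(\<integral>\<^sup>+ s. (\<Sum>i. ennreal (s i * h (s i))) \<partial>\<nu>) = 0" by simp
  then have 2: "AE s in \<nu>. (\<Sum>i. ennreal (s i * h (s i))) = 0"
    by (subst (asm) nn_integral_0_iff_AE) measurable
  from 1 2 show ?thesis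
  proof eventually_elim
    case (elim s)
    have "ennreal (s i * h (s i)) = 0" for i
      using elim(2) by (subst (asm) suminf_eq_zero_iff) auto
    then have *: "s i * h (s i) \<le> 0" for i by (simp add: ennreal_eq_0_iff)
    have "s i = 0 \<or> exp (- b) \<le> s i \<and> s i \<le> exp (- a)" for i
    proof -
      have "0 \<le> s i" using elim(1) by (simp add: mass_partitions_def)
      moreover have "s i \<le> 0" if "0 < s i" "\<not> (exp (- b) \<le> s i \<and> s i \<le> exp (- a))"
        using *[of i] that by (simp add: h_def)
      ultimately show ?thesis by fastforce
    qed
    then show ?case using elim(1) N by (intro bounded_partition_if_large_entries) auto
  qed
qed

text \<open>
  The defining identity of \<open>\<pi>\<close> for test functions of either sign, and for a modification \<open>\<phi>\<close> that turns
  every sequence into a bounded partition and changes only a null set of them.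
\<close>

lemma size_biased_integral:
  assumes h_meas [measurable]: "h \<in> borel_measurable borel" and h_bound: "\<And>x. \<bar>h x\<bar> \<le> D"
    and \<phi>_meas: "\<And>i. (\<lambda>s. \<phi> s i) \<in> borel_measurable \<nu>"
    and \<phi>_good: "\<And>s. bounded_partition N a b (\<phi> s)"
    and \<phi>_id: "\<And>s. bounded_partition N a b s \<Longrightarrow> \<phi> s = s"
  shows "(LINT s|\<nu>. (\<Sum>i<N. \<phi> s i * h (\<phi> s i))) = (LINT x|\<pi>. h (exp (- x)))"
proof -
  interpret n: prob_space \<nu> by (rule prob_space_dislocation[OF \<nu>])
  interpret p: prob_space \<pi> using bias by (simp add: size_biased_law_def)
  have sets_pi [measurable_cong]: "sets \<pi> = sets borel" using bias by (simp add: size_biased_law_def)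
  have D: "0 \<le> D" using h_bound[of 0] by linarith
  have nonneg: "0 \<le> s i" if "bounded_partition N a b s" for s i
  proof -
    have "s i = 0 \<or> exp (- b) \<le> s i" using that unfolding bounded_partition_def by blast
    then show ?thesis using exp_gt_zero[of "- b"] by linarith
  qed
  \<comment> \<open>Adding \<open>D\<close> makes the test function nonnegative and changes both sides by \<open>D\<close>.\<close>
  define g where "g = (\<lambda>x. h x + D)"
  have g: "g \<in> borel_measurable borel" "\<And>x. 0 \<le> g x" "\<And>x. \<bar>g x\<bar> \<le> 2 * D"
  proof -
    show "g \<in> borel_measurable borel" unfolding g_def by measurable
    show "0 \<le> g x" "\<bar>g x\<bar> \<le> 2 * D" for x
      using h_bound[of x] unfolding g_def by linarith+
  qed
  have exp_meas: "(\<lambda>x. g (exp (- x))) \<in> borel_measurable borel"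
    by (rule measurable_compose[OF _ g(1)]) measurable
  have sum_meas: "(\<lambda>s. \<Sum>i<N. \<phi> s i * k (\<phi> s i)) \<in> borel_measurable \<nu>"
    if "k \<in> borel_measurable borel" for k
    by (intro borel_measurable_sum borel_measurable_times \<phi>_meas measurable_compose[OF \<phi>_meas that])
  have "(\<integral>\<^sup>+ s. ennreal (\<Sum>i<N. \<phi> s i * g (\<phi> s i)) \<partial>\<nu>) = (\<integral>\<^sup>+ s. (\<Sum>i. ennreal (s i * g (s i))) \<partial>\<nu>)"
  proof (rule nn_integral_cong_AE)
    show "AE s in \<nu>. ennreal (\<Sum>i<N. \<phi> s i * g (\<phi> s i)) = (\<Sum>i. ennreal (s i * g (s i)))"
      using AE_bounded_partition
    proof eventually_elim
      case (elim s)
      have "(\<Sum>i. ennreal (s i * g (s i))) = (\<Sum>i<N. ennreal (s i * g (s i)))"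
        using elim by (intro suminf_finite) (auto simp: bounded_partition_def)
      also have "\<dots> = ennreal (\<Sum>i<N. s i * g (s i))"
        using nonneg[OF elim] g(2) by (intro sum_ennreal) simp
      finally show ?case using \<phi>_id[OF elim] by simp
    qed
  qed
  also have "\<dots> = (\<integral>\<^sup>+ x. ennreal (g (exp (- x))) \<partial>\<pi>)"
  proof -
    have "bounded (g ` {0..1})" by (rule boundedI[of _ "2 * D"]) (use g(3) in auto)
    then show ?thesis
      using bias measurable_restrict_space1[OF g(1)] g(2) by (simp add: size_biased_law_def)
  qed
  finally have "(LINT s|\<nu>. (\<Sum>i<N. \<phi> s i * g (\<phi> s i))) = (LINT x|\<pi>. g (exp (- x)))"
    using nonneg[OF \<phi>_good] g(2) sum_meas[OF g(1)]
      exp_meas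
    by (subst (1 2) integral_eq_nn_integral)
      (auto intro!: sum_nonneg simp: measurable_cong_sets[OF sets_pi refl])
  moreover have "(LINT x|\<pi>. g (exp (- x))) = (LINT x|\<pi>. h (exp (- x))) + D"
  proof -
    have "integrable \<pi> (\<lambda>x. h (exp (- x)))"
      by (rule p.integrable_const_bound[where B = D]) (use h_bound in auto)
    then show ?thesis
      unfolding g_def using p.prob_space by (subst Bochner_Integration.integral_add) auto
  qed
  moreover have "(LINT s|\<nu>. (\<Sum>i<N. \<phi> s i * g (\<phi> s i))) = (LINT s|\<nu>. (\<Sum>i<N. \<phi> s i * h (\<phi> s i))) + D"
  proof -
    have mass: "(\<Sum>i<N. \<phi> s i) = 1" for s using \<phi>_good[of s] by (simp add: bounded_partition_def)
    have "\<bar>\<Sum>i<N. \<phi> s i * h (\<phi> s i)\<bar> \<le> D" for s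
    proof -
      have "\<bar>\<Sum>i<N. \<phi> s i * h (\<phi> s i)\<bar> \<le> (\<Sum>i<N. \<bar>\<phi> s i * h (\<phi> s i)\<bar>)" by (rule sum_abs)
      also have "\<dots> \<le> (\<Sum>i<N. \<phi> s i * D)"
        using nonneg[OF \<phi>_good] h_bound by (intro sum_mono) (simp add: abs_mult mult_left_mono)
      also have "\<dots> = D" using mass by (simp flip: sum_distrib_right)
      finally show ?thesis .
    qed
    then have "integrable \<nu> (\<lambda>s. \<Sum>i<N. \<phi> s i * h (\<phi> s i))"
      by (intro n.integrable_const_bound[where B = D] sum_meas[OF h_meas]) auto
    moreover have "(\<Sum>i<N. \<phi> s i * g (\<phi> s i)) = (\<Sum>i<N. \<phi> s i * h (\<phi> s i)) + D" for s
      using mass[of s] by (simp add: g_def distrib_left sum.distrib flip: sum_distrib_right)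
    ultimately show ?thesis
      using n.prob_space by (simp add: Bochner_Integration.integral_add)
  qed
  ultimately show ?thesis by simp
qed

end

theorem proposition5p1:
  fixes M :: "'w measure"
    and \<nu> :: "(nat \<Rightarrow> real) measure"
    and \<pi> :: "real measure"
    and X :: "vertex \<Rightarrow> 'w \<Rightarrow> nat \<Rightarrow> real"
    and f :: "real \<Rightarrow> real"
    and a b :: real
  assumes "dislocation_measure \<nu>"
    and "prob_space M"
    and "prob_space.indep_vars M (\<lambda>_. mass_partition_space) X UNIV"
    and "\<And>u. distr M mass_partition_space (X u) = \<nu>"
    and "size_biased_law \<nu> \<pi>"
    and "0 < a" and "a < b" and "measure_support \<pi> = {a..b}"
    and "has_continuous_density \<pi>"
    and "continuous_on {0..1} f"
  shows "AE \<omega> in M.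
           ((\<lambda>T. gamma_T (frag_size (\<lambda>u. X u \<omega>)) T f) \<longlongrightarrow> gamma_infinity \<pi> f) at_top"
proof -
  interpret prob_space M by fact
  interpret p: prob_space \<pi> using assms(5) by (simp add: size_biased_law_def)
  interpret n: prob_space \<nu> by (rule prob_space_dislocation[OF assms(1)])
  have sets_pi: "sets \<pi> = sets borel" using assms(5) by (simp add: size_biased_law_def)
  have jump: "AE x in \<pi>. x \<in> {a..b}"
    using AE_in_measure_support[OF sets_pi] assms(8) by simp
  obtain \<rho> where \<rho>: "continuous_on UNIV \<rho>" "\<And>x. 0 \<le> \<rho> x" "\<And>x. x \<notin> {a..b} \<Longrightarrow> \<rho> x = 0"
    "\<pi> = density lborel (\<lambda>x. ennreal (\<rho> x))"
    by (rule continuous_density_globally[OF assms(9,8,6)]) (use that in blast)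
  obtain N :: nat where N: "exp b < real N" using reals_Archimedean2 by blast
  note good_AE = AE_bounded_partition[OF assms(1,5) jump N]
  obtain s0 where s0: "bounded_partition N a b s0"
  proof -
    have "\<exists>s. bounded_partition N a b s"
    proof (rule ccontr)
      assume "\<not> ?thesis"
      then have "AE s in \<nu>. False" using good_AE by simp
      then show False by simp
    qed
    then show ?thesis using that by blast
  qed
  \<comment> \<open>Replacing exceptional sequences by a fixed bounded partition makes the bounds hold everywhere.\<close>
  define \<phi> where "\<phi> = (\<lambda>s. if bounded_partition N a b s then s else s0)"
  have \<phi>_good: "bounded_partition N a b (\<phi> s)" for s using s0 by (simp add: \<phi>_def)
  have \<phi>_id: "\<phi> s = s" if "bounded_partition N a b s" for s using that by (simp add: \<phi>_def)
  have sets_nu: "sets \<nu> = sets mass_partition_space" using assms(1) by (simp add: dislocation_measure_def)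
  have \<phi>_comp: "(\<lambda>s. \<phi> s i) \<in> borel_measurable \<nu>" for i
  proof -
    note [measurable] = dislocation_component[OF assms(1)]
    have "Measurable.pred \<nu> (bounded_partition N a b)"
      unfolding bounded_partition_def by measurable
    then have "(\<lambda>s. if bounded_partition N a b s then s i else s0 i) \<in> borel_measurable \<nu>"
      by measurable
    then show ?thesis by (simp add: \<phi>_def if_distribR)
  qed
  have "\<phi> \<in> measurable \<nu> seq_space"
    by (rule measurable_PiM_single') (auto simp: \<phi>_comp space_PiM)
  then have \<phi>_meas: "\<phi> \<in> measurable mass_partition_space seq_space"
    using measurable_cong_sets[OF sets_nu refl] by blast
  have X_meas [measurable]: "X u \<in> measurable M mass_partition_space" for u
    using assms(3) by (auto simp: indep_vars_def)
  define R where "R = (\<lambda>u \<omega>. \<phi> (X u \<omega>))"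
  interpret F: fragmentation_density M R N a b \<pi> \<rho>
  proof unfold_locales
    show "0 < a" "a < b" by fact+
    show "R u \<omega> i = 0 \<or> exp (- b) \<le> R u \<omega> i \<and> R u \<omega> i \<le> exp (- a)" for u \<omega> i
      using \<phi>_good[of "X u \<omega>"] by (simp add: R_def bounded_partition_def)
    show "N \<le> i \<Longrightarrow> R u \<omega> i = 0" for u \<omega> i
      using \<phi>_good[of "X u \<omega>"] by (simp add: R_def bounded_partition_def)
    show "(\<Sum>i<N. R u \<omega> i) = 1" for u \<omega>
      using \<phi>_good[of "X u \<omega>"] by (simp add: R_def bounded_partition_def)
    show "indep_vars (\<lambda>_. seq_space) R UNIV"
      unfolding R_def by (rule indep_vars_compose2[OF assms(3)]) (rule \<phi>_meas)
    show "(LINT \<omega>|M. (\<Sum>i<N. R u \<omega> i * h (R u \<omega> i))) = (LINT x|\<pi>. h (exp (- x)))"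
      if h [measurable]: "h \<in> borel_measurable borel" and D: "\<And>x. \<bar>h x\<bar> \<le> D" for h D u
    proof -
      have "(LINT s|distr M mass_partition_space (X u). (\<Sum>i<N. \<phi> s i * h (\<phi> s i)))
          = (LINT \<omega>|M. (\<Sum>i<N. R u \<omega> i * h (R u \<omega> i)))"
        unfolding R_def
      proof (rule integral_distr[OF X_meas])
        have "(\<lambda>s. \<Sum>i<N. \<phi> s i * h (\<phi> s i)) \<in> borel_measurable \<nu>"
          by (intro borel_measurable_sum borel_measurable_times \<phi>_comp
              measurable_compose[OF \<phi>_comp h])
        then show "(\<lambda>s. \<Sum>i<N. \<phi> s i * h (\<phi> s i)) \<in> borel_measurable mass_partition_space"
          using measurable_cong_sets[OF sets_nu refl] by blast
      qed
      then show ?thesis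
        unfolding assms(4)
        using size_biased_integral[OF assms(1,5) jump N h D \<phi>_comp \<phi>_good \<phi>_id] by simp
    qed
    show "0 < measure \<pi> (ball x e)" if "x \<in> {a..b}" "0 < e" for x e
    proof -
      have "x \<in> measure_support \<pi>" using that assms(8) by simp
      then have "0 < emeasure \<pi> (ball x e)" using that(2) by (simp add: measure_support_def)
      then show ?thesis by (simp add: p.emeasure_eq_measure)
    qed
  qed (fact \<rho>)+
  \<comment> \<open>Only the values of \<open>f\<close> on \<open>[0, 1]\<close> enter, so \<open>f\<close> may be extended constantly on both sides.\<close>
  define g where "g = (\<lambda>x. f (max 0 (min 1 x)))"
  have g_cont: "continuous_on UNIV g"
    unfolding g_def
  proof (rule continuous_on_compose2[OF assms(10)])
    show "continuous_on UNIV (\<lambda>x::real. max 0 (min 1 x))" by (intro continuous_intros)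
  qed auto
  have g_eq: "g x = f x" if "x \<in> {0..1}" for x using that by (simp add: g_def)
  have "bounded (f ` {0..1})"
    using assms(10) by (intro compact_imp_bounded compact_continuous_image) auto
  then obtain C where "\<forall>y\<in>f ` {0..1}. norm y \<le> C" unfolding bounded_iff by blast
  then have C: "\<bar>f x\<bar> \<le> C" if "x \<in> {0..1}" for x using that by force
  have g_bound: "\<bar>g x\<bar> \<le> C" for x unfolding g_def by (rule C) auto
  have g_inf: "gamma_infinity \<pi> g = gamma_infinity \<pi> f"
  proof -
    have "(if 0 \<le> y - s then Phi g (y - s) else 0) = (if 0 \<le> y - s then Phi f (y - s) else 0)" for y s
      by (auto simp: Phi_def intro!: g_eq)
    then show ?thesis by (simp add: gamma_infinity_def eta_def)
  qed
  have "AE \<omega> in M. \<forall>u. bounded_partition N a b (X u \<omega>)"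
  proof (rule AE_all_countable[THEN iffD2], rule allI)
    fix u
    show "AE \<omega> in M. bounded_partition N a b (X u \<omega>)"
    proof (rule AE_distrD[OF X_meas])
      show "AE s in distr M mass_partition_space (X u). bounded_partition N a b s"
        unfolding assms(4) by (rule good_AE)
    qed
  qed
  with F.gamma_T_limit[OF g_cont g_bound] show ?thesis
  proof eventually_elim
    case (elim \<omega>)
    interpret bounded_splitting N a b "F.env \<omega>" by (rule F.splitting)
    have env: "(\<lambda>u. R u \<omega>) = (\<lambda>u. X u \<omega>)" using elim(2) by (simp add: R_def \<phi>_def)
    have "gamma_T \<xi> T g = gamma_T \<xi> T f" for T by (rule gamma_T_cong) (rule g_eq)
    then show ?case using elim(1) unfolding g_inf env by simp
  qed
qed

end
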